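(* Fix a finite alphabet $\Sigma$ containing a root label $r$ and a DTD $D$ over $\Sigma$. There is a deterministic bidirectional two-pass streaming algorithm (with no auxiliary streams) which, given as input stream the XML sequence $\mathrm{XML}(t)$ of a binary tree $t$ with $N$ nodes, decides whether $t$ is valid against $D$, using $\mathrm{O}(\log^2 N)$ space and $\mathrm{O}(\log N)$ processing time per letter.
   Context: Trees: finite rooted ordered trees whose nodes are labeled by letters of $\Sigma$, the root being labeled $r$. A binary tree is one in which every node is either a leaf or has exactly two children. For each $a\in\Sigma$ there is an opening tag $a$ and a closing tag $\bar a$. The XML sequence $\mathrm{XML}(t)$ of a tree $t$ is the sequence of tags obtained from a depth-first (left-to-right) traversal of $t$, writing the opening tag of a node's label when the node is first entered and its closing tag when it is left; it has length $2N$ if $t$ has $N$ nodes. The input is assumed well-formed, i.e. it equals $\mathrm{XML}(t)$ for some tree $t$, and its length is known in advance. A DTD is a map $D$ from $\Sigma$ to regular expressions over $\Sigma$; a node labeled $a$ whose children (in order) are labeled $a_1,\dots,a_k$ is valid against $D$ if $a_1\cdots a_k$ matches $D(a)$ (a leaf is valid iff the empty word matches $D(a)$); $t$ is valid against $D$ if all its nodes are. The DTD is fixed and not counted in the space. Streaming model: a pass is one sequential scan of the stream; a bidirectional algorithm may perform passes from left to right and from right to left, and performs at least one in each direction; the space is the size of internal memory (in letters and bits); the processing time per letter is the maximal running time between two consecutive read/write operations; arithmetic on integers in $[0,2N]$ takes constant time. *)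

theory Defs
  imports Complex_Main "HOL-Library.Landau_Symbols" "HOL-Library.Monad_Syntax"
begin

section \<open>Trees, XML sequences and DTDs\<close>

datatype 'a tree = Node (root_label: 'a) (children: "'a tree list")

fun nodes :: "'a tree \<Rightarrow> nat" where
  "nodes (Node a ts) = Suc (sum_list (map nodes ts))"

fun binary :: "'a tree \<Rightarrow> bool" where
  "binary (Node a ts) \<longleftrightarrow> (ts = [] \<or> length ts = 2) \<and> (\<forall>t \<in> set ts. binary t)"

datatype 'a tag = Open 'a | Close 'a

fun XML :: "'a tree \<Rightarrow> 'a tag list" where
  "XML (Node a ts) = Open a # concat (map XML ts) @ [Close a]"

lemma length_XML: "length (XML t) = 2 * nodes t"
proof (induction t)
  case (Node a ts)
  then have "sum_list (map (length \<circ> XML) ts) = 2 * sum_list (map nodes ts)"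
    by (induction ts) auto
  then show ?case by (simp add: length_concat)
qed

datatype 'a rexp =
    Empty_Set
  | Epsilon
  | Atom 'a
  | Alt "'a rexp" "'a rexp"
  | Concat "'a rexp" "'a rexp"
  | Star "'a rexp"

primrec lang :: "'a rexp \<Rightarrow> 'a list set" where
  "lang Empty_Set = {}"
| "lang Epsilon = {[]}"
| "lang (Atom a) = {[a]}"
| "lang (Alt e f) = lang e \<union> lang f"
| "lang (Concat e f) = {u @ v | u v. u \<in> lang e \<and> v \<in> lang f}"
| "lang (Star e) = {concat us | us. set us \<subseteq> lang e}"

type_synonym 'a dtd = "'a \<Rightarrow> 'a rexp"

fun valid :: "'a dtd \<Rightarrow> 'a tree \<Rightarrow> bool" where
  "valid D (Node a ts) \<longleftrightarrow> map root_label ts \<in> lang (D a) \<and> (\<forall>t \<in> set ts. valid D t)"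


section \<open>Streaming algorithms\<close>

text \<open>
  A streaming algorithm is one fixed program of a random access machine, used for all inputs.
  Its internal memory consists of integer cells, which hold numbers between 0 and the length of
  the input stream (this is \<open>2 N\<close> for a tree with \<open>N\<close> nodes), and of letter
  cells, which hold one tag of the stream. Cells are identified by pairs \<open>(A, i)\<close>: the
  cell with index \<open>i\<close> of the array \<open>A\<close>. The cell \<open>(A, 0)\<close> serves as the
  register \<open>A\<close>. All cells are initially unused (\<open>None\<close>). The only access to the
  stream is by reading its next letter in the current pass, and there is no other stream.
\<close>

type_synonym loc = "nat \<times> nat"

text \<open>The operand \<open>At A x\<close> is the array cell \<open>A[x]\<close>, where the index is the content of the
  integer register \<open>x\<close>.\<close>

datatype operand = Reg nat | At nat nat

datatype int_expr =
    Const nat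
  | Stream_Length
  | Content operand
  | Plus operand operand
  | Minus operand operand
  | Times operand operand
  | Div operand operand
  | Mod operand operand

text \<open>The alphabet is finite, hence the functions and predicates in \<open>Set_Letter\<close> and
  \<open>Letters\<close>, which are applied to a fixed number of letters, are finite tables
  that are part of the program.\<close>

datatype 'a test =
    Less operand operand
  | Equal operand operand
  | Letters "operand list" "'a tag list \<Rightarrow> bool"

datatype direction = Left_To_Right | Right_To_Left

datatype 'a com =
    Begin_Pass direction
  | Read operand
  | Set_Int operand int_expr
  | Set_Letter operand "operand list" "'a tag list \<Rightarrow> 'a tag"
  | Seq "'a com" "'a com"
  | Cond "'a test" "'a com" "'a com"
  | While "'a test" "'a com"
  | Answer bool

text \<open>The control is the list of commands that remain to be executed. For a fixed program it
  takes only finitely many values, independently of the input, so that it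
  plays the role of a program counter and does not contribute to the space. The component
  \<open>unread\<close> is the part of the stream that remains to be read in the current pass; it is
  not part of the internal memory either.\<close>

record 'a config =
  control :: "'a com list"
  unread :: "'a tag list"
  ints :: "loc \<rightharpoonup> nat"
  letters :: "loc \<rightharpoonup> 'a tag"
  answer :: "bool option"

definition initial :: "'a com \<Rightarrow> 'a config" where
  "initial P = \<lparr>control = [P], unread = [], ints = Map.empty, letters = Map.empty, answer = None\<rparr>"

fun location :: "'a config \<Rightarrow> operand \<Rightarrow> loc option" where
  "location s (Reg x) = Some (x, 0)"
| "location s (At A x) = do { i \<leftarrow> ints s (x, 0); Some (A, i) }"

definition int_at :: "'a config \<Rightarrow> operand \<Rightarrow> nat option" where
  "int_at s x = do { l \<leftarrow> location s x; ints s l }"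

definition letter_at :: "'a config \<Rightarrow> operand \<Rightarrow> 'a tag option" where
  "letter_at s x = do { l \<leftarrow> location s x; letters s l }"

text \<open>The subtraction is the one of \<open>nat\<close>, so negative differences are replaced by 0.\<close>

fun int_value :: "nat \<Rightarrow> 'a config \<Rightarrow> int_expr \<Rightarrow> nat option" where
  "int_value n s (Const k) = Some k"
| "int_value n s Stream_Length = Some n"
| "int_value n s (Content x) = int_at s x"
| "int_value n s (Plus x y) = do { i \<leftarrow> int_at s x; j \<leftarrow> int_at s y; Some (i + j) }"
| "int_value n s (Minus x y) = do { i \<leftarrow> int_at s x; j \<leftarrow> int_at s y; Some (i - j) }"
| "int_value n s (Times x y) = do { i \<leftarrow> int_at s x; j \<leftarrow> int_at s y; Some (i * j) }"
| "int_value n s (Div x y) = do { i \<leftarrow> int_at s x; j \<leftarrow> int_at s y; Some (i div j) }"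
| "int_value n s (Mod x y) = do { i \<leftarrow> int_at s x; j \<leftarrow> int_at s y; Some (i mod j) }"

fun test_value :: "'a config \<Rightarrow> 'a test \<Rightarrow> bool option" where
  "test_value s (Less x y) = do { i \<leftarrow> int_at s x; j \<leftarrow> int_at s y; Some (i < j) }"
| "test_value s (Equal x y) = do { i \<leftarrow> int_at s x; j \<leftarrow> int_at s y; Some (i = j) }"
| "test_value s (Letters xs p) = do { as \<leftarrow> those (map (letter_at s) xs); Some (p as) }"

text \<open>One computation step on the stream \<open>w\<close>; the result \<open>None\<close> means that the machine has
  halted (empty control) or that it is stuck. It is stuck if it uses a cell without content, if it
  tries to store a number greater than the length of the stream, if it reads past the end of
  the stream, and if it begins a new pass or answers before the current pass is completed.\<close>

fun exec :: "'a tag list \<Rightarrow> 'a com \<Rightarrow> 'a config \<Rightarrow> 'a config option" where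
  "exec w (Begin_Pass d) s =
     (if unread s = []
      then Some (s\<lparr>unread := (case d of Left_To_Right \<Rightarrow> w | Right_To_Left \<Rightarrow> rev w)\<rparr>)
      else None)"
| "exec w (Read x) s =
     (case unread s of
        [] \<Rightarrow> None
      | a # as \<Rightarrow> do { l \<leftarrow> location s x; Some (s\<lparr>unread := as, letters := (letters s)(l \<mapsto> a)\<rparr>) })"
| "exec w (Set_Int x e) s =
     do { l \<leftarrow> location s x; i \<leftarrow> int_value (length w) s e;
          if i \<le> length w then Some (s\<lparr>ints := (ints s)(l \<mapsto> i)\<rparr>) else None }"
| "exec w (Set_Letter x xs f) s =
     do { l \<leftarrow> location s x; as \<leftarrow> those (map (letter_at s) xs);
          Some (s\<lparr>letters := (letters s)(l \<mapsto> f as)\<rparr>) }"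
| "exec w (Seq c1 c2) s = Some (s\<lparr>control := c1 # c2 # control s\<rparr>)"
| "exec w (Cond b c1 c2) s =
     do { v \<leftarrow> test_value s b; Some (s\<lparr>control := (if v then c1 else c2) # control s\<rparr>) }"
| "exec w (While b c) s =
     do { v \<leftarrow> test_value s b;
          Some (if v then s\<lparr>control := c # While b c # control s\<rparr> else s) }"
| "exec w (Answer v) s =
     (if unread s = [] then Some (s\<lparr>control := [], answer := Some v\<rparr>) else None)"

definition step :: "'a tag list \<Rightarrow> 'a config \<Rightarrow> 'a config option" where
  "step w s = (case control s of [] \<Rightarrow> None | c # k \<Rightarrow> exec w c (s\<lparr>control := k\<rparr>))"

definition computation :: "'a com \<Rightarrow> 'a tag list \<Rightarrow> 'a config list \<Rightarrow> bool" where
  "computation P w cs \<longleftrightarrow>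
     cs \<noteq> [] \<and> hd cs = initial P \<and>
     (\<forall>i. Suc i < length cs \<longrightarrow> step w (cs ! i) = Some (cs ! Suc i)) \<and>
     control (last cs) = []"

lemma computation_unique:
  assumes "computation P w cs" "computation P w ds"
  shows "cs = ds"
proof -
  have *: "i < length ds \<and> ds ! i = cs ! i"
    if "computation P w cs" "computation P w ds" "i < length cs" for cs ds and i
    using that(3)
  proof (induction i)
    case 0
    then show ?case using that(1,2) by (auto simp: computation_def hd_conv_nth)
  next
    case (Suc i)
    then have i: "i < length ds" "ds ! i = cs ! i" by auto
    have st: "step w (cs ! i) = Some (cs ! Suc i)"
      using that(1) Suc.prems by (auto simp: computation_def)
    then have "control (ds ! i) \<noteq> []" using i by (auto simp: step_def)
    then have "i \<noteq> length ds - 1"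
      using that(2) by (auto simp: computation_def last_conv_nth)
    then have "Suc i < length ds" using i by linarith
    moreover from this have "step w (ds ! i) = Some (ds ! Suc i)"
      using that(2) by (auto simp: computation_def)
    ultimately show ?case using st i by simp
  qed
  from *[OF assms] *[OF assms(2) assms(1)] show ?thesis
    by (metis nth_equalityI linorder_neq_iff less_irrefl)
qed

definition passes :: "'a config list \<Rightarrow> direction list" where
  "passes cs = concat (map (\<lambda>s. case control s of Begin_Pass d # _ \<Rightarrow> [d] | _ \<Rightarrow> []) cs)"

definition bidirectional_two_pass :: "'a config list \<Rightarrow> bool" where
  "bidirectional_two_pass cs \<longleftrightarrow>
     length (passes cs) = 2 \<and> Left_To_Right \<in> set (passes cs) \<and> Right_To_Left \<in> set (passes cs)"

text \<open>An array is charged for all cells up to the largest index in use. No cell ever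
  becomes unused again, and finitely many steps use finitely many cells.\<close>

definition footprint :: "(loc \<rightharpoonup> 'b) \<Rightarrow> loc set" where
  "footprint m = {(A, j) | A j. \<exists>i \<ge> j. (A, i) \<in> dom m}"

text \<open>The number of letters and bits in memory, where \<open>n\<close> is the length of the stream and each
  integer cell needs the bits for a number in \<open>{0..n}\<close>.\<close>

definition config_space :: "nat \<Rightarrow> 'a config \<Rightarrow> nat" where
  "config_space n s =
     card (footprint (ints s)) * nat \<lceil>log 2 (real (n + 1))\<rceil> + card (footprint (letters s))"

definition space_used :: "nat \<Rightarrow> 'a config list \<Rightarrow> nat" where
  "space_used n cs = Max (config_space n ` set cs)"

definition reading :: "'a config \<Rightarrow> bool" where
  "reading s \<longleftrightarrow> (\<exists>x k. control s = Read x # k)"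

text \<open>The maximal number of steps between two consecutive read operations. The beginning and the
  end of the computation are treated like read operations, so the steps before the first
  and after the last letter count as well.\<close>

definition processing_time :: "'a config list \<Rightarrow> nat" where
  "processing_time cs =
     Max {j - i | i j. i \<le> j \<and> j < length cs \<and> (\<forall>k. i < k \<and> k < j \<longrightarrow> \<not> reading (cs ! k))}"

end

theory Submission
  imports Defs "HOL-Library.Sublist" "HOL-Real_Asymp.Real_Asymp"
begin

text \<open>
  In the left-to-right pass, an internal node with left child labeled \<open>b\<close> and right child
  labeled \<open>c\<close> is remembered from the point \<open>Close b, Open c\<close> between its subtrees until its own
  closing tag, where all three labels are known. The nodes remembered at one time have the current
  position in their right subtrees. Those that are left-heavy, i.e. at least as heavy on the left
  as on the right, at least double in size from each one to the next one outside. The sizes of the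
  left subtrees are not known, but they are bounded by the distance to the preceding stack entry,
  and an entry is dropped if its right subtree turns out to be larger than this bound. So the stack
  has logarithmic length and all left-heavy nodes are checked. The right-to-left pass does the same
  for the mirrored tree and thus checks the right-heavy nodes.
\<close>

section \<open>The algorithm on lists\<close>

fun conforms :: "('a \<Rightarrow> 'a list \<Rightarrow> bool) \<Rightarrow> 'a tree \<Rightarrow> bool" where
  "conforms V (Node a ts) \<longleftrightarrow> V a (map root_label ts) \<and> (\<forall>t \<in> set ts. conforms V t)"

text \<open>The inner premise is vacuous unless there are exactly two children, so leaves are always
  checked; ties count as left-heavy.\<close>

fun conforms_left_heavy :: "('a \<Rightarrow> 'a list \<Rightarrow> bool) \<Rightarrow> 'a tree \<Rightarrow> bool" where
  "conforms_left_heavy V (Node a ts) \<longleftrightarrow>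
     ((\<forall>t1 t2. ts = [t1, t2] \<longrightarrow> nodes t2 \<le> nodes t1) \<longrightarrow> V a (map root_label ts)) \<and>
     (\<forall>t \<in> set ts. conforms_left_heavy V t)"

fun mirror :: "'a tree \<Rightarrow> 'a tree" where
  "mirror (Node a ts) = Node a (rev (map mirror ts))"

fun swap_tag :: "'a tag \<Rightarrow> 'a tag" where
  "swap_tag (Open a) = Close a"
| "swap_tag (Close a) = Open a"

lemma root_label_mirror [simp]: "root_label (mirror t) = root_label t"
  by (cases t) simp

lemma nodes_mirror [simp]: "nodes (mirror t) = nodes t"
proof (induction t)
  case (Node a ts)
  then have "map (nodes \<circ> mirror) ts = map nodes ts" by simp
  moreover have "nodes (mirror (Node a ts)) = Suc (sum_list (rev (map (nodes \<circ> mirror) ts)))"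
    by (simp add: rev_map)
  ultimately show ?case by (simp add: sum_list_rev del: map_eq_conv)
qed

lemma binary_mirror [simp]: "binary (mirror t) \<longleftrightarrow> binary t"
  by (induction t) auto

text \<open>Scanning the stream backwards and swapping opening and closing tags shows the XML
  sequence of the mirrored tree. The second pass can therefore reuse the procedure of the first
  one.\<close>

lemma XML_mirror: "XML (mirror t) = map swap_tag (rev (XML t))"
proof (induction t)
  case (Node a ts)
  then have "map (XML \<circ> mirror) (rev ts) = map (map swap_tag \<circ> (rev \<circ> XML)) (rev ts)" by simp
  then show ?case by (simp add: rev_concat rev_map map_concat comp_assoc del: map_eq_conv)
qed

lemma valid_iff_conforms: "valid D t \<longleftrightarrow> conforms (\<lambda>a u. u \<in> lang (D a)) t"
  by (induction t) auto

lemma conforms_mirror: "conforms (\<lambda>a u. V a (rev u)) (mirror t) \<longleftrightarrow> conforms V t"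
  by (induction t) (auto simp: rev_map comp_def)

text \<open>A node whose right subtree is strictly larger becomes left-heavy in the mirror image;
  all others are covered by the first assumption. Mirroring reverses the word of child labels, hence
  \<open>rev u\<close>.\<close>

lemma conforms_if_left_heavy_both:
  assumes "conforms_left_heavy V t" "conforms_left_heavy (\<lambda>a u. V a (rev u)) (mirror t)"
  shows "conforms V t"
  using assms
proof (induction t)
  case (Node a ts)
  show ?case
  proof (cases "\<exists>t1 t2. ts = [t1, t2] \<and> nodes t1 < nodes t2")
    case True
    then obtain t1 t2 where "ts = [t1, t2]" "nodes t1 < nodes t2" by blast
    then show ?thesis using Node by simp
  next
    case False
    then have "\<forall>t1 t2. ts = [t1, t2] \<longrightarrow> nodes t2 \<le> nodes t1" using leI by blast
    then show ?thesis using Node by (simp add: rev_map comp_def)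
  qed
qed

section \<open>Compression of the stack\<close>

text \<open>An entry \<open>(q, d, b)\<close> of the stack, whose top is the last element, stands for an unfinished
  node of depth \<open>d\<close> with left child labeled \<open>b\<close>; \<open>q\<close> is the position at which its
  right child was opened. For an entry below it with position \<open>q'\<close>, the left subtree has at most
  \<open>q - q'\<close> tags.\<close>

type_synonym 'a entry = "nat \<times> nat \<times> 'a"

text \<open>Positions count from 1, so the default 0 acts as a sentinel below the bottom
  entry.\<close>

definition top_pos :: "'a entry list \<Rightarrow> nat" where
  "top_pos st = (if st = [] then 0 else fst (last st))"

text \<open>Here \<open>fst e - top_pos st\<close> is the available bound on the left subtree, and
  \<open>p - fst e\<close> is the number of tags of the right subtree before position
  \<open>p\<close>. The comparison is strict, so ties stay.\<close>

definition keep :: "nat \<Rightarrow> 'a entry list \<Rightarrow> 'a entry \<Rightarrow> 'a entry list" where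
  "keep p st e = (if fst e - top_pos st < p - fst e then st else st @ [e])"

definition compress :: "nat \<Rightarrow> 'a entry list \<Rightarrow> 'a entry list" where
  "compress p = foldl (keep p) []"

text \<open>The age of \<open>e\<close> is at most its gap to 0 and to every lower entry, written
  without subtraction. Unlike the test in \<open>keep\<close>, this does not depend on which lower
  entries have survived.\<close>

definition protected :: "nat \<Rightarrow> 'a entry list \<Rightarrow> 'a entry \<Rightarrow> bool" where
  "protected p st e \<longleftrightarrow>
     p \<le> 2 * fst e \<and> (\<forall>e' \<in> set st. fst e' < fst e \<longrightarrow> p + fst e' \<le> 2 * fst e)"

text \<open>Protection at the end of a subtree thus yields protection at every earlier compression
  and relative to every thinned stack.\<close>

lemma protected_mono:
  "protected p st e \<Longrightarrow> p' \<le> p \<Longrightarrow> set st' \<subseteq> set st \<Longrightarrow> protected p' st' e"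
  unfolding protected_def by (meson add_le_mono1 order_trans subsetD)

lemma compress_snoc: "compress p (st @ [e]) = keep p (compress p st) e"
  by (simp add: compress_def)

lemma subseq_compress: "subseq (compress p st) st"
proof (induction st rule: rev_induct)
  case (snoc e st)
  then show ?case by (simp add: compress_snoc keep_def subseq_rev_drop_many)
qed (simp add: compress_def)

lemma set_subseq: "subseq xs ys \<Longrightarrow> set xs \<subseteq> set ys"
  by (auto dest: list_emb_set)

lemma subseq_sorted_wrt: "subseq xs ys \<Longrightarrow> sorted_wrt R ys \<Longrightarrow> sorted_wrt R xs"
  by (induction rule: list_emb.induct) (auto dest: set_subseq)

text \<open>When \<open>e\<close> is tested, the entry below it is either an older element of
  \<open>st\<close> or the sentinel 0, and protection bounds the age by the gap in both
  cases.\<close>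

lemma compress_protected:
  assumes "sorted_wrt (<) (map fst st)" "e \<in> set st" "protected p st e"
  shows "e \<in> set (compress p st)"
  using assms
proof (induction st rule: rev_induct)
  case (snoc x st)
  show ?case
  proof (cases "e \<in> set st")
    case True
    have "protected p st e" using snoc.prems(3) by (rule protected_mono) auto
    then show ?thesis using snoc True by (auto simp: compress_snoc keep_def sorted_wrt_append)
  next
    case False
    then have [simp]: "e = x" using snoc.prems by simp
    have "p + top_pos (compress p st) \<le> 2 * fst x"
    proof (cases "compress p st = []")
      case False
      then have "last (compress p st) \<in> set st" using set_subseq[OF subseq_compress] last_in_set by blast
      then show ?thesis using snoc.prems False
        by (auto simp: sorted_wrt_append top_pos_def protected_def)
    qed (use snoc.prems in \<open>simp add: top_pos_def protected_def\<close>)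
    then show ?thesis by (auto simp: compress_snoc keep_def)
  qed
qed simp

text \<open>Each kept entry at least halves the distance to the current position.\<close>

lemma compress_halving:
  assumes "\<forall>e \<in> set st. fst e < p"
  shows "2 ^ length (compress p st) * (p - top_pos (compress p st)) \<le> p"
  using assms
proof (induction st rule: rev_induct)
  case (snoc e st)
  let ?c = "compress p st"
  show ?case
  proof (cases "fst e - top_pos ?c < p - fst e")
    case False
    then have "2 * (p - fst e) \<le> p - top_pos ?c" using snoc.prems by auto
    then have "2 ^ length ?c * (2 * (p - fst e)) \<le> 2 ^ length ?c * (p - top_pos ?c)" by simp
    also have "\<dots> \<le> p" using snoc by simp
    finally show ?thesis using False by (simp add: compress_snoc keep_def top_pos_def ac_simps)
  qed (use snoc in \<open>simp add: compress_snoc keep_def\<close>)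
qed (simp add: compress_def top_pos_def)

text \<open>In \<open>compress_halving\<close> the remaining distance is at least 1, because all
  kept positions are smaller than \<open>p\<close>. This makes the stack logarithmic.\<close>

lemma length_compress:
  assumes "\<forall>e \<in> set st. fst e < p" "0 < p"
  shows "2 ^ length (compress p st) \<le> p"
proof -
  have "top_pos (compress p st) < p"
  proof (cases "compress p st = []")
    case False
    then have "last (compress p st) \<in> set st" using set_subseq[OF subseq_compress] last_in_set by blast
    then show ?thesis using assms False by (simp add: top_pos_def)
  qed (use assms in \<open>simp add: top_pos_def\<close>)
  then have "2 ^ length (compress p st) * 1 \<le> 2 ^ length (compress p st) * (p - top_pos (compress p st))"
    by (intro mult_left_mono) auto
  also have "\<dots> \<le> p" using compress_halving[OF assms(1)] .
  finally show ?thesis by simp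
qed

section \<open>One pass over a binary tree\<close>

text \<open>The components of a state are the last tag, the depth, the position, the stack and
  the verdict so far.\<close>

type_synonym 'a state = "'a tag \<times> nat \<times> nat \<times> 'a entry list \<times> bool"

text \<open>Two consecutive tags determine the event: descent to a left child, a leaf, the change
  from left to right subtree, or the end of an internal node. A dropped entry shows only as a depth
  mismatch at the top, and the node then passes unchecked.\<close>

fun astep :: "('a \<Rightarrow> 'a list \<Rightarrow> bool) \<Rightarrow> 'a state \<Rightarrow> 'a tag \<Rightarrow> 'a state" where
  "astep V (Open a, d, p, st, ok) (Open b) = (Open b, Suc d, Suc p, st, ok)"
| "astep V (Open a, d, p, st, ok) (Close b) = (Close b, d - 1, Suc p, st, ok \<and> V b [])"
| "astep V (Close b, d, p, st, ok) (Open c) =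
     (Open c, Suc d, Suc p, compress (Suc p) st @ [(Suc p, d, b)], ok)"
| "astep V (Close c, d, p, st, ok) (Close a) =
     (if st \<noteq> [] \<and> fst (snd (last st)) = d
      then (Close a, d - 1, Suc p, butlast st, ok \<and> V a [snd (snd (last st)), c])
      else (Close a, d - 1, Suc p, st, ok))"

lemma XML_conv_tl: "XML t = Open (root_label t) # tl (XML t)"
  by (cases t) simp

text \<open>Which right-heavy nodes get checked depends on the surrounding stack, so the verdict is
  only enclosed between full and left-heavy conformance. Outer entries have depth below
  \<open>d\<close> and hence are never popped inside \<open>t\<close>; they can only be lost by
  compression, which spares the protected ones.\<close>

lemma foldl_astep_tree:
  assumes "binary t" "sorted_wrt (<) (map fst st)" "\<forall>e \<in> set st. fst e \<le> p \<and> fst (snd e) < d"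
  shows "\<exists>st' ok'.
    foldl (astep V) (Open (root_label t), d, p, st, ok) (tl (XML t)) =
      (Close (root_label t), d - 1, p + 2 * nodes t - 1, st', ok') \<and>
    subseq st' st \<and>
    (\<forall>e \<in> set st. protected (p + 2 * nodes t - 1) st e \<longrightarrow> e \<in> set st') \<and>
    (ok' \<longrightarrow> ok \<and> conforms_left_heavy V t) \<and> (ok \<and> conforms V t \<longrightarrow> ok')"
  using assms
proof (induction t arbitrary: d p st ok)
  case (Node a ts)
  from Node.prems(1) consider "ts = []" | t1 t2 where "ts = [t1, t2]"
    by (auto simp: length_Suc_conv numeral_2_eq_2)
  then show ?case
  proof cases
    case 1
    then show ?thesis by simp
  next
    case 2
    let ?b = "root_label t1" and ?c = "root_label t2"
    let ?q = "p + 2 * nodes t1 + 1"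
    have pos: "nodes t1 > 0" "nodes t2 > 0" by (cases t1, simp, cases t2, simp)
    have sub: "t1 \<in> set ts" "binary t1" "t2 \<in> set ts" "binary t2"
      using 2 Node.prems(1) by auto
    have bounds0: "\<forall>e \<in> set st. fst e \<le> Suc p \<and> fst (snd e) < Suc d"
      using Node.prems(3) by auto
    obtain st1 ok1 where 1:
      "foldl (astep V) (Open ?b, Suc d, Suc p, st, ok) (tl (XML t1)) = (Close ?b, Suc d - 1, Suc p + 2 * nodes t1 - 1, st1, ok1)"
      "subseq st1 st" "\<forall>e \<in> set st. protected (Suc p + 2 * nodes t1 - 1) st e \<longrightarrow> e \<in> set st1"
      "ok1 \<longrightarrow> ok \<and> conforms_left_heavy V t1" "ok \<and> conforms V t1 \<longrightarrow> ok1"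
      using Node.IH[of t1 st "Suc p" "Suc d" ok] sub(1,2) Node.prems(2) bounds0 by blast
    define st2 where "st2 = compress ?q st1"
    have sub2: "subseq st2 st" unfolding st2_def
      using subseq_compress 1(2) subseq_order.trans by blast
    have sorted1: "sorted_wrt (<) (map fst st1)"
      and sorted2: "sorted_wrt (<) (map fst st2)"
      using Node.prems(2) 1(2) sub2 by (meson subseq_map subseq_sorted_wrt)+
    have bounds: "fst e \<le> p \<and> fst (snd e) < d" if "e \<in> set st2" for e
      using that Node.prems(3) set_subseq[OF sub2] by blast
    let ?e = "(?q, d, ?b)"
    have sorted3: "sorted_wrt (<) (map fst (st2 @ [?e]))"
      using sorted2 bounds by (fastforce simp: sorted_wrt_append)
    have bounds3: "\<forall>e \<in> set (st2 @ [?e]). fst e \<le> ?q \<and> fst (snd e) < Suc d"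
      using bounds by fastforce
    obtain st3 ok3 where 3:
      "foldl (astep V) (Open ?c, Suc d, ?q, st2 @ [?e], ok1) (tl (XML t2)) = (Close ?c, Suc d - 1, ?q + 2 * nodes t2 - 1, st3, ok3)"
      "subseq st3 (st2 @ [?e])"
      "\<forall>e \<in> set (st2 @ [?e]). protected (?q + 2 * nodes t2 - 1) (st2 @ [?e]) e \<longrightarrow> e \<in> set st3"
      "ok3 \<longrightarrow> ok1 \<and> conforms_left_heavy V t2" "ok1 \<and> conforms V t2 \<longrightarrow> ok3"
      using Node.IH[of t2 "st2 @ [?e]" ?q "Suc d" ok1] sub(3,4) sorted3 bounds3 by blast
    define r where "r = ?q + 2 * nodes t2 - 1"
    have tags: "tl (XML (Node a ts)) =
        (Open ?b # tl (XML t1)) @ (Open ?c # tl (XML t2)) @ [Close a]"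
      unfolding XML_conv_tl[symmetric] using 2 by simp
    have run: "foldl (astep V) (Open a, d, p, st, ok) (tl (XML (Node a ts))) =
        astep V (Close ?c, d, r, st3, ok3) (Close a)"
      unfolding tags using 1(1) 3(1) by (simp add: st2_def r_def)
    have end_pos: "p + 2 * nodes (Node a ts) - 1 = Suc r"
      using 2 pos by (simp add: r_def)
    \<comment> \<open>Beyond a part of \<open>st2\<close>, only the node's own entry
      \<open>?e\<close> can be left, and then on top. So the closing tag finds it there or finds it
      dropped.\<close>
    obtain ys where ys: "subseq ys st2" "st3 = ys \<or> st3 = ys @ [?e]"
    proof -
      obtain us vs where "st3 = us @ vs" "subseq us st2" "subseq vs [?e]"
        using 3(2) subseq_appendE by blast
      moreover from \<open>subseq vs [?e]\<close> have "vs = [] \<or> vs = [?e]"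
        by (cases vs) (auto split: if_splits)
      ultimately show ?thesis using that by auto
    qed
    have ys_st: "subseq ys st" using ys(1) sub2 subseq_order.trans by blast
    have ys_depth: "fst (snd e) < d" if "e \<in> set ys" for e
      using that set_subseq[OF ys(1)] bounds by blast
    have ys_not: "?e \<notin> set ys" using ys_depth[of ?e] by auto
    \<comment> \<open>Protection at \<open>Suc r\<close> is passed down to the three places where
      \<open>e\<close> could be lost: the left subtree, the compression at \<open>?q\<close> and the
      right subtree.\<close>
    have kept: "e \<in> set ys" if e: "e \<in> set st" "protected (Suc r) st e" for e
    proof -
      have "protected (Suc p + 2 * nodes t1 - 1) st e"
        using e(2) by (rule protected_mono) (simp_all add: r_def)
      then have e1: "e \<in> set st1" using 1(3) e(1) by blast
      have "protected ?q st1 e"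
        using e(2) by (rule protected_mono) (use pos set_subseq[OF 1(2)] in \<open>simp_all add: r_def\<close>)
      then have e2: "e \<in> set st2" unfolding st2_def
        using compress_protected sorted1 e1 by blast
      have "protected (Suc r) st2 e"
        using e(2) by (rule protected_mono) (use set_subseq[OF sub2] in simp_all)
      \<comment> \<open>The new entry has a larger position than \<open>e\<close>, so it adds no
        condition.\<close>
      then have "protected r (st2 @ [?e]) e"
        using bounds[OF e2] by (auto simp: protected_def)
      then have "e \<in> set st3" using 3(3) e2 by (simp add: r_def)
      then show ?thesis using ys(2) bounds[OF e2] by auto
    qed
    show ?thesis
    proof (cases "st3 = ys")
      case True
      have notprot: "\<not> nodes t2 \<le> nodes t1"
      proof
        assume le: "nodes t2 \<le> nodes t1"
        \<comment> \<open>The age of \<open>?e\<close> at \<open>r\<close> is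
          \<open>2 * nodes t2 - 1\<close>, while its gap to any lower entry is at least
          \<open>2 * nodes t1 + 1\<close>, as those lie at positions up to \<open>p\<close>.\<close>
        have "protected r (st2 @ [?e]) ?e"
          using le bounds by (fastforce simp: protected_def r_def)
        then have "?e \<in> set st3" using 3(3) by (simp add: r_def)
        then show False using True ys_not by simp
      qed
      \<comment> \<open>All remaining entries belong to proper ancestors, so the depth test
        fails.\<close>
      have nd: "\<not> (ys \<noteq> [] \<and> fst (snd (last ys)) = d)"
        using ys_depth last_in_set by (metis less_irrefl)
      have "foldl (astep V) (Open a, d, p, st, ok) (tl (XML (Node a ts))) =
          (Close a, d - 1, Suc r, ys, ok3)"
        unfolding run True astep.simps if_not_P[OF nd] ..
      moreover have "ok3 \<longrightarrow> ok \<and> conforms_left_heavy V (Node a ts)"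
        using 1(4) 3(4) 2 notprot by simp
      moreover have "ok \<and> conforms V (Node a ts) \<longrightarrow> ok3"
        using 1(5) 3(5) 2 by simp
      ultimately show ?thesis using ys_st kept unfolding end_pos tree.sel
        by (intro exI[of _ ys] exI[of _ "ok3"]) blast
    next
      case False
      then have "foldl (astep V) (Open a, d, p, st, ok) (tl (XML (Node a ts))) =
          (Close a, d - 1, Suc r, ys, ok3 \<and> V a [?b, ?c])"
        unfolding run using ys(2) by simp
      moreover have "ok3 \<and> V a [?b, ?c] \<longrightarrow> ok \<and> conforms_left_heavy V (Node a ts)"
        using 1(4) 3(4) 2 by simp
      moreover have "ok \<and> conforms V (Node a ts) \<longrightarrow> ok3 \<and> V a [?b, ?c]"
        using 1(5) 3(5) 2 by simp
      ultimately show ?thesis using ys_st kept unfolding end_pos tree.sel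
        by (intro exI[of _ ys] exI[of _ "ok3 \<and> V a [?b, ?c]"]) blast
    qed
  qed
qed

text \<open>The first tag only initializes the state, which explains position 1. The argument
  \<open>ok\<close> carries the result of an earlier pass.\<close>

definition verdict :: "('a \<Rightarrow> 'a list \<Rightarrow> bool) \<Rightarrow> bool \<Rightarrow> 'a tag list \<Rightarrow> bool" where
  "verdict V ok xs = snd (snd (snd (snd (foldl (astep V) (hd xs, 0, 1, [], ok) (tl xs)))))"

lemma verdict_XML:
  assumes "binary t"
  shows "verdict V ok (XML t) \<Longrightarrow> ok \<and> conforms_left_heavy V t"
    and "ok \<Longrightarrow> conforms V t \<Longrightarrow> verdict V ok (XML t)"
proof -
  have "hd (XML t) = Open (root_label t)" by (cases t) simp
  then show "verdict V ok (XML t) \<Longrightarrow> ok \<and> conforms_left_heavy V t"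
    and "ok \<Longrightarrow> conforms V t \<Longrightarrow> verdict V ok (XML t)"
    using foldl_astep_tree[OF assms, of "[]" 1 0 V ok] by (auto simp: verdict_def)
qed

text \<open>If both passes accept, all left-heavy nodes of the tree and of its mirror image conform,
  hence all nodes. Conversely, no pass rejects a conforming tree.\<close>

lemma verdict_both:
  assumes "binary t"
  shows "verdict (\<lambda>a u. rev u \<in> lang (D a)) (verdict (\<lambda>a u. u \<in> lang (D a)) True (XML t))
      (map swap_tag (rev (XML t))) \<longleftrightarrow> valid D t" (is "?v \<longleftrightarrow> _")
proof
  assume ?v
  then show "valid D t"
    using assms verdict_XML(1)[of t] verdict_XML(1)[of "mirror t"]
      conforms_if_left_heavy_both[of "\<lambda>a u. u \<in> lang (D a)" t]
    unfolding valid_iff_conforms XML_mirror[symmetric] by (metis binary_mirror)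
next
  assume "valid D t"
  then show ?v
    using assms verdict_XML(2)[of t] verdict_XML(2)[of "mirror t"]
      conforms_mirror[of "\<lambda>a u. u \<in> lang (D a)" t]
    unfolding valid_iff_conforms XML_mirror[symmetric] by simp
qed

section \<open>Reasoning about programs\<close>

text \<open>The answer is fixed to \<open>None\<close>, so the calculus below covers the run up to
  the final \<open>Answer\<close>, for which \<open>pre\<close> is false.\<close>

definition cfg :: "'a com list \<Rightarrow> 'a tag list \<Rightarrow> (loc \<rightharpoonup> nat) \<Rightarrow> (loc \<rightharpoonup> 'a tag) \<Rightarrow> 'a config" where
  "cfg k u I L = \<lparr>control = k, unread = u, ints = I, letters = L, answer = None\<rparr>"

lemma cfg_simps [simp]:
  "control (cfg k u I L) = k" "unread (cfg k u I L) = u" "ints (cfg k u I L) = I"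
  "letters (cfg k u I L) = L" "answer (cfg k u I L) = None"
  "(cfg k u I L)\<lparr>control := k'\<rparr> = cfg k' u I L"
  "(cfg k u I L)\<lparr>unread := u'\<rparr> = cfg k u' I L"
  "(cfg k u I L)\<lparr>ints := I'\<rparr> = cfg k u I' L"
  "(cfg k u I L)\<lparr>letters := L'\<rparr> = cfg k u I L'"
  by (simp_all add: cfg_def)

section \<open>Clocked runs and their time and space bounds\<close>

definition pass_begun :: "'a config \<Rightarrow> direction list" where
  "pass_begun s = (case control s of Begin_Pass d # _ \<Rightarrow> [d] | _ \<Rightarrow> [])"

text \<open>Configurations are paired with a clock, which counts the steps since the last reading
  configuration, and with the passes begun so far. The clock is only checked against the bound
  \<open>T\<close> when a letter is read.\<close>

type_synonym 'a clocked = "'a config \<times> nat \<times> direction list"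

definition clocked_step :: "'a tag list \<Rightarrow> nat \<Rightarrow> 'a clocked \<Rightarrow> 'a clocked \<Rightarrow> bool" where
  "clocked_step w T = (\<lambda>(s, q, ps) (s', q', ps'). step w s = Some s' \<and>
     (reading s \<longrightarrow> q \<le> T) \<and> q' = (if reading s then 1 else Suc q) \<and> ps' = ps @ pass_begun s)"

text \<open>A window without inner reading configurations either reaches the current configuration,
  and then the clock \<open>q\<close> bounds it, or it ended earlier and was bounded by
  \<open>T\<close> when a letter was read, or by the clock before that.\<close>

lemma clocked_run:
  assumes "(clocked_step w T)\<^sup>*\<^sup>* (initial P, 0, []) (s, q, ps)" "0 < T"
  shows "\<exists>cs. cs \<noteq> [] \<and> hd cs = initial P \<and> last cs = s \<and>
    (\<forall>i. Suc i < length cs \<longrightarrow> step w (cs ! i) = Some (cs ! Suc i)) \<and>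
    concat (map pass_begun (butlast cs)) = ps \<and>
    (\<forall>i < length cs. (\<forall>k. i < k \<and> k < length cs - 1 \<longrightarrow> \<not> reading (cs ! k)) \<longrightarrow>
       length cs - 1 - i \<le> q) \<and>
    (\<forall>i j. i \<le> j \<and> j < length cs \<and> (\<forall>k. i < k \<and> k < j \<longrightarrow> \<not> reading (cs ! k)) \<longrightarrow>
       j - i \<le> max T q)"
  using assms(1)
proof (induction rule: rtranclp_induct[of "clocked_step w T" "(a, b, c)" "(s, q, ps)" for a b c s q ps, split_format (complete), consumes 1, case_names refl step])
  case refl
  show ?case by (rule exI[of _ "[initial P]"]) simp
next
  case (step s q ps s' q' ps')
  then obtain cs where cs: "cs \<noteq> []" "hd cs = initial P" "last cs = s"
    "\<forall>i. Suc i < length cs \<longrightarrow> step w (cs ! i) = Some (cs ! Suc i)"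
    "concat (map pass_begun (butlast cs)) = ps"
    "\<And>i. i < length cs \<Longrightarrow> \<forall>k. i < k \<and> k < length cs - 1 \<longrightarrow> \<not> reading (cs ! k) \<Longrightarrow> length cs - 1 - i \<le> q"
    "\<And>i j. i \<le> j \<Longrightarrow> j < length cs \<Longrightarrow> \<forall>k. i < k \<and> k < j \<longrightarrow> \<not> reading (cs ! k) \<Longrightarrow> j - i \<le> max T q"
    by blast
  let ?ds = "cs @ [s']"
  have st: "step w s = Some s'" "reading s \<Longrightarrow> q \<le> T" "q' = (if reading s then 1 else Suc q)"
    "ps' = ps @ pass_begun s"
    using step.hyps(2) by (auto simp: clocked_step_def)
  have last: "cs ! (length cs - 1) = s" using cs(1,3) by (simp add: last_conv_nth)
  have steps: "step w (?ds ! i) = Some (?ds ! Suc i)" if "Suc i < length ?ds" for i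
  proof (cases "Suc i = length cs")
    case True
    then have "i = length cs - 1" by simp
    then show ?thesis using True last st(1) by (simp add: nth_append)
  next
    case False
    then show ?thesis using that cs(4) by (simp add: nth_append)
  qed
  have passes: "concat (map pass_begun (butlast ?ds)) = ps'"
    using cs(1,3,5) st(4) by (simp, subst append_butlast_last_id[symmetric], simp, simp del: append_butlast_last_id)
  have windows: "length ?ds - 1 - i \<le> q'"
    if i: "i < length ?ds" "\<forall>k. i < k \<and> k < length ?ds - 1 \<longrightarrow> \<not> reading (?ds ! k)" for i
  proof (cases "i < length cs - 1")
    case True
    then have nr: "\<not> reading s" using i(2)[rule_format, of "length cs - 1"] last cs(1)
      by (simp add: nth_append)
    have "\<not> reading (cs ! k)" if "i < k" "k < length cs - 1" for k
      using i(2)[rule_format, of k] that by (simp add: nth_append)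
    then have "length cs - 1 - i \<le> q" using cs(6)[of i] True by auto
    then show ?thesis using nr st(3) by simp
  next
    case False
    then show ?thesis using st(3) by auto
  qed
  have "j - i \<le> max T q'"
    if ij: "i \<le> j" "j < length ?ds" "\<forall>k. i < k \<and> k < j \<longrightarrow> \<not> reading (?ds ! k)" for i j
  proof (cases "j < length cs")
    case True
    then have "\<forall>k. i < k \<and> k < j \<longrightarrow> \<not> reading (cs ! k)"
      using ij(3) by (auto simp: nth_append)
    then have "j - i \<le> max T q" using cs(7) ij(1) True by blast
    then show ?thesis using st(2,3) by (auto split: if_splits)
  next
    case False
    then have "j = length ?ds - 1" using ij(2) by simp
    then show ?thesis using windows[of i] ij by (simp add: le_max_iff_disj)
  qed
  then have "?ds \<noteq> [] \<and> hd ?ds = initial P \<and> last ?ds = s' \<and>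
    (\<forall>i. Suc i < length ?ds \<longrightarrow> step w (?ds ! i) = Some (?ds ! Suc i)) \<and>
    concat (map pass_begun (butlast ?ds)) = ps' \<and>
    (\<forall>i < length ?ds. (\<forall>k. i < k \<and> k < length ?ds - 1 \<longrightarrow> \<not> reading (?ds ! k)) \<longrightarrow>
       length ?ds - 1 - i \<le> q') \<and>
    (\<forall>i j. i \<le> j \<and> j < length ?ds \<and> (\<forall>k. i < k \<and> k < j \<longrightarrow> \<not> reading (?ds ! k)) \<longrightarrow>
       j - i \<le> max T q')"
    using cs(1,2) steps passes windows by simp
  then show ?case by blast
qed

lemma step_dom_mono:
  assumes "step w s = Some s'"
  shows "dom (ints s) \<subseteq> dom (ints s') \<and> dom (letters s) \<subseteq> dom (letters s')"
proof -
  have "dom (ints s) \<subseteq> dom (ints s') \<and> dom (letters s) \<subseteq> dom (letters s')"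
    if "exec w c s = Some s'" for c and s :: "'a config"
    using that by (cases c) (auto split: if_splits list.splits bind_splits)
  then show ?thesis using assms by (fastforce simp: step_def split: list.splits)
qed

text \<open>No cell is ever released, so the space bound only requires the domains in the last
  configuration.\<close>

lemma steps_dom_mono:
  assumes "\<forall>i. Suc i < length cs \<longrightarrow> step w (cs ! i) = Some (cs ! Suc i)" "s \<in> set cs"
  shows "dom (ints s) \<subseteq> dom (ints (last cs)) \<and> dom (letters s) \<subseteq> dom (letters (last cs))"
proof -
  have "dom (ints (cs ! i)) \<subseteq> dom (ints (cs ! j)) \<and> dom (letters (cs ! i)) \<subseteq> dom (letters (cs ! j))"
    if "i \<le> j" "j < length cs" for i j
    using that
  proof (induction j rule: dec_induct)
    case (step j)
    then have "step w (cs ! j) = Some (cs ! Suc j)" using assms(1) by simp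
    from step_dom_mono[OF this] show ?case using step by (meson Suc_lessD order_trans)
  qed simp
  moreover obtain i where "i < length cs" "s = cs ! i" using assms(2) by (metis in_set_conv_nth)
  ultimately show ?thesis by (metis Suc_pred' diff_Suc_1 last_conv_nth length_greater_0_conv
      less_Suc_eq_le list.size(3) not_less_zero lessI)
qed

lemma card_footprint:
  assumes "dom m \<subseteq> {..a} \<times> {..K}"
  shows "card (footprint m) \<le> Suc a * Suc K"
proof -
  have "footprint m \<subseteq> {..a} \<times> {..K}" using assms by (fastforce simp: footprint_def)
  then have "card (footprint m) \<le> card ({..a} \<times> {..K})" by (intro card_mono) auto
  then show ?thesis by (simp add: card_cartesian_product)
qed

lemma computation_bounds:
  assumes "(clocked_step w T)\<^sup>*\<^sup>* (initial P, 0, []) (s, q, ps)" "0 < T" "q \<le> T"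
    and "control s = []" "dom (ints s) \<subseteq> {..a} \<times> {..K}" "dom (letters s) \<subseteq> {..a} \<times> {..K}"
  shows "\<exists>cs. computation P w cs \<and> last cs = s \<and> passes cs = ps \<and> processing_time cs \<le> T \<and>
    space_used n cs \<le> Suc a * Suc K * (nat \<lceil>log 2 (real (n + 1))\<rceil> + 1)"
proof -
  obtain cs where cs: "cs \<noteq> []" "hd cs = initial P" "last cs = s"
    "\<forall>i. Suc i < length cs \<longrightarrow> step w (cs ! i) = Some (cs ! Suc i)"
    "concat (map pass_begun (butlast cs)) = ps"
    "\<forall>i j. i \<le> j \<and> j < length cs \<and> (\<forall>k. i < k \<and> k < j \<longrightarrow> \<not> reading (cs ! k)) \<longrightarrow> j - i \<le> max T q"
    using clocked_run[OF assms(1,2)] by blast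
  have "computation P w cs" using cs(1-4) assms(4) by (simp add: computation_def)
  moreover have "passes cs = ps"
  proof -
    have "passes cs = concat (map pass_begun (butlast cs @ [s]))"
      unfolding passes_def pass_begun_def using cs(1,3) by (metis append_butlast_last_id)
    then show ?thesis using cs(5) assms(4) by (simp add: pass_begun_def)
  qed
  moreover have "processing_time cs \<le> T"
  proof -
    let ?W = "{j - i | i j. i \<le> j \<and> j < length cs \<and> (\<forall>k. i < k \<and> k < j \<longrightarrow> \<not> reading (cs ! k))}"
    have bd: "\<forall>x \<in> ?W. x \<le> T" using cs(6) assms(3) by (auto simp: max_def)
    then have "finite ?W" by (meson finite_nat_set_iff_bounded_le)
    moreover have "0 - 0 \<in> ?W" using cs(1) by blast
    then have "?W \<noteq> {}" by blast
    ultimately show ?thesis unfolding processing_time_def using bd by (intro Max.boundedI) auto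
  qed
  moreover have "space_used n cs \<le> Suc a * Suc K * (nat \<lceil>log 2 (real (n + 1))\<rceil> + 1)"
    unfolding space_used_def
  proof (rule Max.boundedI)
    fix x assume "x \<in> config_space n ` set cs"
    then obtain s' where s': "s' \<in> set cs" "x = config_space n s'" by blast
    have "dom (ints s') \<subseteq> {..a} \<times> {..K}" "dom (letters s') \<subseteq> {..a} \<times> {..K}"
      using steps_dom_mono[OF cs(4) s'(1)] assms(5,6) unfolding cs(3) by (meson order_trans)+
    from this[THEN card_footprint]
    \<comment> \<open>Both kinds of cells lie in the same box; an integer cell costs its bits, a
      letter cell costs 1.\<close>
    have "x \<le> Suc a * Suc K * nat \<lceil>log 2 (real (n + 1))\<rceil> + Suc a * Suc K"
      unfolding s'(2) config_space_def by (intro add_mono mult_le_mono1)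
    then show "x \<le> Suc a * Suc K * (nat \<lceil>log 2 (real (n + 1))\<rceil> + 1)" by (simp add: algebra_simps)
  qed (use cs(1) in auto)
  ultimately show ?thesis using cs(3) by blast
qed

section \<open>Weakest preconditions\<close>

type_synonym 'a post = "'a tag list \<Rightarrow> (loc \<rightharpoonup> nat) \<Rightarrow> (loc \<rightharpoonup> 'a tag) \<Rightarrow> nat \<Rightarrow> direction list \<Rightarrow> bool"

text \<open>The arbitrary continuation \<open>k\<close> makes commands composable. The run has to
  reach it, so termination is included.\<close>

definition wp :: "'a tag list \<Rightarrow> nat \<Rightarrow> 'a com \<Rightarrow> 'a post \<Rightarrow> 'a post" where
  "wp w T c Q u I L q ps \<longleftrightarrow> (\<forall>k. \<exists>u' I' L' q' ps'.
     (clocked_step w T)\<^sup>*\<^sup>* (cfg (c # k) u I L, q, ps) (cfg k u' I' L', q', ps') \<and> Q u' I' L' q' ps')"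

lemma wp_mono:
  assumes "wp w T c Q u I L q ps" "\<And>u I L q ps. Q u I L q ps \<Longrightarrow> R u I L q ps"
  shows "wp w T c R u I L q ps"
  using assms unfolding wp_def by meson

lemma wp_step:
  assumes "\<And>k. clocked_step w T (cfg (c # k) u I L, q, ps) (cfg k u' I' L', q', ps')"
    "Q u' I' L' q' ps'"
  shows "wp w T c Q u I L q ps"
  using assms unfolding wp_def by blast

text \<open>Evaluation ignores the control, which is normalized to \<open>[]\<close>; the
  \<open>NO_MATCH\<close> premise keeps the rewriting from looping.\<close>

lemma int_at_cfg: "NO_MATCH [] k \<Longrightarrow> int_at (cfg k u I L) x = int_at (cfg [] u I L) x"
  by (cases x) (simp_all add: int_at_def)

lemma letter_at_cfg: "NO_MATCH [] k \<Longrightarrow> letter_at (cfg k u I L) = letter_at (cfg [] u I L)"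
proof
  show "letter_at (cfg k u I L) x = letter_at (cfg [] u I L) x" for x
    by (cases x) (simp_all add: letter_at_def)
qed

lemma location_cfg: "NO_MATCH [] k \<Longrightarrow> location (cfg k u I L) x = location (cfg [] u I L) x"
  by (cases x) simp_all

lemma int_value_cfg: "NO_MATCH [] k \<Longrightarrow> int_value n (cfg k u I L) e = int_value n (cfg [] u I L) e"
  by (cases e) (simp_all add: int_at_cfg)

lemma test_value_cfg: "NO_MATCH [] k \<Longrightarrow> test_value (cfg k u I L) b = test_value (cfg [] u I L) b"
  by (cases b) (simp_all add: int_at_cfg letter_at_cfg)

text \<open>A single unrolling; whole loops are treated by induction with this rule.\<close>

lemma wp_While:
  assumes "case test_value (cfg [] u I L) b of None \<Rightarrow> False
    | Some v \<Rightarrow> if v then wp w T c (wp w T (While b c) Q) u I L (Suc q) ps else Q u I L (Suc q) ps"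
  shows "wp w T (While b c) Q u I L q ps"
proof -
  from assms obtain v where v: "test_value (cfg k u I L) b = Some v" for k
    by (auto simp: test_value_cfg split: option.splits)
  show ?thesis
  proof (cases v)
    case True
    with assms v have *: "wp w T c (wp w T (While b c) Q) u I L (Suc q) ps" by simp
    show ?thesis unfolding wp_def
    proof
      fix k
      have "clocked_step w T (cfg (While b c # k) u I L, q, ps) (cfg (c # While b c # k) u I L, Suc q, ps)"
        using True v by (simp add: clocked_step_def step_def reading_def pass_begun_def)
      moreover obtain u1 I1 L1 q1 ps1 where
        "(clocked_step w T)\<^sup>*\<^sup>* (cfg (c # While b c # k) u I L, Suc q, ps) (cfg (While b c # k) u1 I1 L1, q1, ps1)"
        "wp w T (While b c) Q u1 I1 L1 q1 ps1"
        using * unfolding wp_def[of w T c] by blast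
      moreover obtain u2 I2 L2 q2 ps2 where
        "(clocked_step w T)\<^sup>*\<^sup>* (cfg (While b c # k) u1 I1 L1, q1, ps1) (cfg k u2 I2 L2, q2, ps2)"
        "Q u2 I2 L2 q2 ps2"
        using calculation(3) unfolding wp_def by blast
      ultimately show "\<exists>u' I' L' q' ps'. (clocked_step w T)\<^sup>*\<^sup>* (cfg (While b c # k) u I L, q, ps)
          (cfg k u' I' L', q', ps') \<and> Q u' I' L' q' ps'"
        by (meson converse_rtranclp_into_rtranclp rtranclp_trans)
    qed
  next
    case False
    with assms v have *: "Q u I L (Suc q) ps" by simp
    show ?thesis
      by (rule wp_step[where Q = Q, OF _ *]) (use False v in \<open>simp add: clocked_step_def step_def reading_def pass_begun_def\<close>)
  qed
qed

text \<open>A weakest precondition by recursion on loop-free commands, to be evaluated by simplification.\<close>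

fun pre :: "'a tag list \<Rightarrow> nat \<Rightarrow> 'a com \<Rightarrow> 'a post \<Rightarrow> 'a post" where
  "pre w T (Begin_Pass d) Q u I L q ps \<longleftrightarrow>
     u = [] \<and> Q (case d of Left_To_Right \<Rightarrow> w | Right_To_Left \<Rightarrow> rev w) I L (Suc q) (ps @ [d])"
| "pre w T (Read x) Q u I L q ps \<longleftrightarrow>
     (case u of [] \<Rightarrow> False | a # as \<Rightarrow>
       (case location (cfg [] u I L) x of None \<Rightarrow> False | Some l \<Rightarrow> q \<le> T \<and> Q as I (L(l \<mapsto> a)) 1 ps))"
| "pre w T (Set_Int x e) Q u I L q ps \<longleftrightarrow>
     (case location (cfg [] u I L) x of None \<Rightarrow> False | Some l \<Rightarrow>
       (case int_value (length w) (cfg [] u I L) e of None \<Rightarrow> False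
        | Some i \<Rightarrow> i \<le> length w \<and> Q u (I(l \<mapsto> i)) L (Suc q) ps))"
| "pre w T (Set_Letter x xs f) Q u I L q ps \<longleftrightarrow>
     (case location (cfg [] u I L) x of None \<Rightarrow> False | Some l \<Rightarrow>
       (case those (map (letter_at (cfg [] u I L)) xs) of None \<Rightarrow> False
        | Some as \<Rightarrow> Q u I (L(l \<mapsto> f as)) (Suc q) ps))"
| "pre w T (Seq c1 c2) Q u I L q ps \<longleftrightarrow> pre w T c1 (pre w T c2 Q) u I L (Suc q) ps"
| "pre w T (Cond b c1 c2) Q u I L q ps \<longleftrightarrow>
     (case test_value (cfg [] u I L) b of None \<Rightarrow> False
      | Some v \<Rightarrow> if v then pre w T c1 Q u I L (Suc q) ps else pre w T c2 Q u I L (Suc q) ps)"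
| "pre w T (While b c) Q u I L q ps \<longleftrightarrow> wp w T (While b c) Q u I L q ps"
| "pre w T (Answer v) Q u I L q ps \<longleftrightarrow> False"

lemma wp_Seq:
  assumes "wp w T c1 (wp w T c2 Q) u I L (Suc q) ps"
  shows "wp w T (Seq c1 c2) Q u I L q ps"
  unfolding wp_def
proof
  fix k
  have "clocked_step w T (cfg (Seq c1 c2 # k) u I L, q, ps) (cfg (c1 # c2 # k) u I L, Suc q, ps)"
    by (simp add: clocked_step_def step_def reading_def pass_begun_def)
  moreover obtain u1 I1 L1 q1 ps1 where
    "(clocked_step w T)\<^sup>*\<^sup>* (cfg (c1 # c2 # k) u I L, Suc q, ps) (cfg (c2 # k) u1 I1 L1, q1, ps1)"
    "wp w T c2 Q u1 I1 L1 q1 ps1"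
    using assms unfolding wp_def[of w T c1] by blast
  moreover obtain u2 I2 L2 q2 ps2 where
    "(clocked_step w T)\<^sup>*\<^sup>* (cfg (c2 # k) u1 I1 L1, q1, ps1) (cfg k u2 I2 L2, q2, ps2)"
    "Q u2 I2 L2 q2 ps2"
    using calculation(3) unfolding wp_def by blast
  ultimately show "\<exists>u' I' L' q' ps'. (clocked_step w T)\<^sup>*\<^sup>* (cfg (Seq c1 c2 # k) u I L, q, ps)
      (cfg k u' I' L', q', ps') \<and> Q u' I' L' q' ps'"
    by (meson converse_rtranclp_into_rtranclp rtranclp_trans)
qed

lemma wp_Cond:
  assumes "test_value (cfg [] u I L) b = Some v" "wp w T (if v then c1 else c2) Q u I L (Suc q) ps"
  shows "wp w T (Cond b c1 c2) Q u I L q ps"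
  unfolding wp_def
proof
  fix k
  have "clocked_step w T (cfg (Cond b c1 c2 # k) u I L, q, ps) (cfg ((if v then c1 else c2) # k) u I L, Suc q, ps)"
    using assms(1) by (simp add: clocked_step_def step_def reading_def pass_begun_def test_value_cfg)
  then show "\<exists>u' I' L' q' ps'. (clocked_step w T)\<^sup>*\<^sup>* (cfg (Cond b c1 c2 # k) u I L, q, ps)
      (cfg k u' I' L', q', ps') \<and> Q u' I' L' q' ps'"
    using assms(2) unfolding wp_def by (meson converse_rtranclp_into_rtranclp)
qed

lemma wp_if_pre: "pre w T c Q u I L q ps \<Longrightarrow> wp w T c Q u I L q ps"
proof (induction c arbitrary: Q u I L q ps)
  case (Begin_Pass d)
  then show ?case
    by (intro wp_step[where c = "Begin_Pass d"])
       (auto simp: clocked_step_def step_def reading_def pass_begun_def)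
next
  case (Read x)
  then show ?case
    by (auto split: list.splits option.splits intro!: wp_step
        simp: clocked_step_def step_def reading_def pass_begun_def location_cfg)
next
  case (Set_Int x e)
  then show ?case
    by (auto split: option.splits intro!: wp_step
        simp: clocked_step_def step_def reading_def pass_begun_def location_cfg int_value_cfg)
next
  case (Set_Letter x xs f)
  then show ?case
    by (auto split: option.splits intro!: wp_step
        simp: clocked_step_def step_def reading_def pass_begun_def location_cfg letter_at_cfg)
next
  case (Seq c1 c2)
  from Seq.prems have "pre w T c1 (pre w T c2 Q) u I L (Suc q) ps" by simp
  then have "wp w T c1 (pre w T c2 Q) u I L (Suc q) ps" by (rule Seq.IH(1))
  then show ?case by (intro wp_Seq) (rule wp_mono, assumption, rule Seq.IH(2))
next
  case (Cond b c1 c2)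
  then show ?case by (auto split: option.splits if_splits intro: wp_Cond)
qed auto

section \<open>The program\<close>

abbreviation seq (infixr ";;" 60) where "c1 ;; c2 \<equiv> Seq c1 c2"

text \<open>Cell \<open>m + 1\<close> of the arrays \<open>9\<close>, \<open>10\<close> and \<open>2\<close> (for letters)
  holds the three components of entry \<open>m\<close> of the stack. Register \<open>9\<close> contains 0, the position
  compared with the bottom entry. Register \<open>10\<close> contains the length of the stream, which
  differs from all depths, so that the test at the end of a node fails on the empty stack.\<close>

abbreviation "one \<equiv> Reg 0"
abbreviation "pos \<equiv> Reg 1"
abbreviation "depth \<equiv> Reg 2"
abbreviation "height \<equiv> Reg 3"
abbreviation "src \<equiv> Reg 4"
abbreviation "dst \<equiv> Reg 5"
abbreviation "gap \<equiv> Reg 6"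
abbreviation "age \<equiv> Reg 7"
abbreviation "ok \<equiv> Reg 8"
abbreviation "zero \<equiv> Reg 9"
abbreviation "len \<equiv> Reg 10"
abbreviation "positions x \<equiv> At 9 x"
abbreviation "depths x \<equiv> At 10 x"
text \<open>Integer and letter cells are separate memories, so register numbers may
  coincide.\<close>

abbreviation "prev \<equiv> Reg 0"
abbreviation "cur \<equiv> Reg 1"
abbreviation "labels x \<equiv> At 2 x"

text \<open>Register \<open>one\<close> already holds 1 whenever this is executed, so only a step is
  spent.\<close>

abbreviation "skip \<equiv> Set_Int one (Const 1)"

fun is_open :: "'a tag \<Rightarrow> bool" where
  "is_open (Open a) = True"
| "is_open (Close a) = False"

fun label :: "'a tag \<Rightarrow> 'a" where
  "label (Open a) = a"
| "label (Close a) = a"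

text \<open>An in-place version of \<open>keep\<close>: \<open>dst\<close> is the cell of the last
  kept entry, or 0 if there is none, so \<open>positions 5\<close> is \<open>top_pos\<close> in both
  cases.\<close>

definition compress_step :: "'a com" where
  "compress_step =
     Set_Int src (Plus src one) ;;
     Set_Int gap (Minus (positions 4) (positions 5)) ;;
     Set_Int age (Minus pos (positions 4)) ;;
     Cond (Less gap age) skip
       (Set_Int dst (Plus dst one) ;;
        Set_Int (positions 5) (Content (positions 4)) ;;
        Set_Int (depths 5) (Content (depths 4)) ;;
        Set_Letter (labels 5) [labels 4] hd)"

text \<open>This runs after \<open>pos\<close> and before \<open>depth\<close> is incremented, as in
  \<open>astep\<close>. The label is copied from \<open>prev\<close>, hence stored as a closing
  tag.\<close>

definition push :: "'a com" where
  "push =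
     Set_Int src (Const 0) ;;
     Set_Int dst (Const 0) ;;
     While (Less src height) compress_step ;;
     Set_Int height (Plus dst one) ;;
     Set_Int (positions 3) (Content pos) ;;
     Set_Int (depths 3) (Content depth) ;;
     Set_Letter (labels 3) [prev] hd"

definition check :: "('a \<Rightarrow> 'a list \<Rightarrow> bool) \<Rightarrow> 'a com" where
  "check V =
     Cond (Letters [prev] (is_open \<circ> hd))
       (Cond (Letters [cur] (\<lambda>as. V (label (hd as)) [])) skip (Set_Int ok (Const 0)))
       (Cond (Equal (depths 3) depth)
          (Cond (Letters [cur, labels 3, prev]
               (\<lambda>as. V (label (as ! 0)) [label (as ! 1), label (as ! 2)]))
             skip (Set_Int ok (Const 0)) ;;
           Set_Int height (Minus height one))
          skip)"

definition letter_step :: "('a tag \<Rightarrow> 'a tag) \<Rightarrow> ('a \<Rightarrow> 'a list \<Rightarrow> bool) \<Rightarrow> 'a com" where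
  "letter_step f V =
     Read cur ;;
     Set_Letter cur [cur] (f \<circ> hd) ;;
     Set_Int pos (Plus pos one) ;;
     Cond (Letters [cur] (is_open \<circ> hd))
       (Cond (Letters [prev] (is_open \<circ> hd)) skip push ;; Set_Int depth (Plus depth one))
       (check V ;; Set_Int depth (Minus depth one)) ;;
     Set_Letter prev [cur] hd"

text \<open>The first tag is read outside the loop, so that \<open>prev\<close> is defined in every
  \<open>letter_step\<close>.\<close>

definition pass :: "direction \<Rightarrow> ('a tag \<Rightarrow> 'a tag) \<Rightarrow> ('a \<Rightarrow> 'a list \<Rightarrow> bool) \<Rightarrow> 'a com" where
  "pass d f V =
     Begin_Pass d ;;
     Set_Int pos (Const 1) ;;
     Set_Int depth (Const 0) ;;
     Set_Int height (Const 0) ;;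
     Read cur ;;
     Set_Letter cur [cur] (f \<circ> hd) ;;
     Set_Letter prev [cur] hd ;;
     While (Less pos len) (letter_step f V)"

definition both_passes :: "'a dtd \<Rightarrow> 'a com" where
  "both_passes D =
     Set_Int one (Const 1) ;;
     Set_Int ok (Const 1) ;;
     Set_Int zero (Const 0) ;;
     Set_Int len Stream_Length ;;
     pass Left_To_Right id (\<lambda>a u. u \<in> lang (D a)) ;;
     pass Right_To_Left swap_tag (\<lambda>a u. rev u \<in> lang (D a))"

definition program :: "'a dtd \<Rightarrow> 'a com" where
  "program D = both_passes D ;; Cond (Equal ok one) (Answer True) (Answer False)"

section \<open>Memory contents and the compression loop\<close>

definition stored :: "(loc \<rightharpoonup> nat) \<Rightarrow> (loc \<rightharpoonup> 'a tag) \<Rightarrow> nat \<Rightarrow> 'a entry \<Rightarrow> bool" where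
  "stored I L m e \<longleftrightarrow> I (9, Suc m) = Some (fst e) \<and> I (10, Suc m) = Some (fst (snd e)) \<and>
     L (2, Suc m) = Some (Close (snd (snd e)))"

text \<open>These facts hold across both passes; \<open>v\<close> is the verdict so far, and the box
  of arrays up to 10 and indices up to \<open>K\<close> yields the space bound.\<close>

definition const_cells :: "nat \<Rightarrow> nat \<Rightarrow> nat \<Rightarrow> (loc \<rightharpoonup> nat) \<Rightarrow> (loc \<rightharpoonup> 'a tag) \<Rightarrow> bool" where
  "const_cells n K v I L \<longleftrightarrow>
     I (0, 0) = Some 1 \<and> I (8, 0) = Some v \<and> I (9, 0) = Some 0 \<and> I (10, 0) = Some n \<and>
     dom I \<subseteq> {..10} \<times> {..K} \<and> dom L \<subseteq> {..10} \<times> {..K}"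

definition frame :: "nat \<Rightarrow> nat \<Rightarrow> nat \<Rightarrow> nat \<Rightarrow> nat \<Rightarrow> nat \<Rightarrow> 'a tag \<Rightarrow> 'a tag \<Rightarrow>
    (loc \<rightharpoonup> nat) \<Rightarrow> (loc \<rightharpoonup> 'a tag) \<Rightarrow> bool" where
  "frame n K p d k v y x I L \<longleftrightarrow> const_cells n K v I L \<and>
     I (1, 0) = Some p \<and> I (2, 0) = Some d \<and> I (3, 0) = Some k \<and>
     L (0, 0) = Some y \<and> L (1, 0) = Some x"

lemmas frame_defs = frame_def const_cells_def

lemmas eval_defs = int_at_def letter_at_def

text \<open>Since \<open>length acc \<le> i\<close>, a kept entry is written no further than the
  cell just read, and the unprocessed entries stay intact.\<close>

lemma wp_compress_step:
  assumes "frame (length w) K p d k v y x I L" "I (4, 0) = Some i" "I (5, 0) = Some (length acc)"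
    "\<forall>m < length acc. stored I L m (acc ! m)" "\<forall>m. i \<le> m \<and> m < k \<longrightarrow> stored I L m (st ! m)"
    "i < k" "length acc \<le> i" "k \<le> K" "k \<le> length w" "p \<le> length w"
    "\<forall>m < k. fst (st ! m) \<le> length w \<and> fst (snd (st ! m)) \<le> length w"
  shows "wp w T compress_step (\<lambda>u' I' L' q' ps'. u' = u \<and> ps' = ps \<and> q' \<le> q + 15 \<and>
      frame (length w) K p d k v y x I' L' \<and> I' (4, 0) = Some (Suc i) \<and>
      I' (5, 0) = Some (length (keep p acc (st ! i))) \<and>
      (\<forall>m < length (keep p acc (st ! i)). stored I' L' m (keep p acc (st ! i) ! m)) \<and>
      (\<forall>m. Suc i \<le> m \<and> m < k \<longrightarrow> stored I' L' m (st ! m))) u I L q ps"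
    (is "wp _ _ _ ?Q _ _ _ _ _")
proof -
  have base: "I (9, length acc) = Some (top_pos acc)"
  proof (cases acc rule: rev_cases)
    case Nil
    then show ?thesis using assms(1) by (simp add: top_pos_def frame_defs)
  next
    case (snoc acc' e)
    then show ?thesis using assms(4) by (auto simp: top_pos_def stored_def)
  qed
  have "stored I L i (st ! i)" using assms(5,6) by simp
  then obtain e where e: "st ! i = e" "I (9, Suc i) = Some (fst e)" "I (10, Suc i) = Some (fst (snd e))"
    "L (2, Suc i) = Some (Close (snd (snd e)))" "fst e \<le> length w" "fst (snd e) \<le> length w"
    using assms(6,11) by (auto simp: stored_def)
  \<comment> \<open>The machine is stuck on numbers above the stream length, so both differences
    have to be bounded before they are stored.\<close>
  have diffs: "fst e - j \<le> length w" "p - j \<le> length w" for j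
    using e(5) assms(10) by auto
  have later: "\<forall>m. Suc i \<le> m \<and> m < k \<longrightarrow> stored I L m (st ! m)" using assms(5) by simp
  note hyps = assms(1-3,6-10) base e diffs
  show ?thesis
  proof (rule wp_if_pre, cases "fst e - top_pos acc < p - fst e")
    case True
    then show "pre w T compress_step ?Q u I L q ps"
      using hyps later assms(4)
      by (simp add: frame_defs eval_defs keep_def compress_step_def) (simp add: stored_def)
  next
    case False
    then show "pre w T compress_step ?Q u I L q ps"
      using hyps later assms(4)
      by (simp add: frame_defs eval_defs keep_def compress_step_def) (auto simp add: stored_def nth_append)
  qed
qed

text \<open>Each entry costs 15 steps for the body and one for the test; the last, failing test adds
  1.\<close>

lemma wp_compress_loop:
  assumes "frame (length w) K p d (length st) v y x I L" "I (4, 0) = Some i" "I (5, 0) = Some (length acc)"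
    "\<forall>m < length acc. stored I L m (acc ! m)" "\<forall>m. i \<le> m \<and> m < length st \<longrightarrow> stored I L m (st ! m)"
    "i \<le> length st" "length acc \<le> i" "length st \<le> K" "length st \<le> length w" "p \<le> length w"
    "\<forall>e \<in> set st. fst e \<le> length w \<and> fst (snd e) \<le> length w"
    "\<And>I' L' q'. q' \<le> q + 16 * (length st - i) + 1 \<Longrightarrow>
       frame (length w) K p d (length st) v y x I' L' \<Longrightarrow>
       I' (5, 0) = Some (length (foldl (keep p) acc (drop i st))) \<Longrightarrow>
       \<forall>m < length (foldl (keep p) acc (drop i st)).
         stored I' L' m (foldl (keep p) acc (drop i st) ! m) \<Longrightarrow> Q u I' L' q' ps"
  shows "wp w T (While (Less src height) compress_step) Q u I L q ps"
  using assms
proof (induction "length st - i" arbitrary: i acc I L q)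
  case 0
  then show ?case by (intro wp_While) (simp add: frame_defs eval_defs)
next
  case (Suc n)
  then have i: "i < length st" by simp
  have test: "test_value (cfg [] u I L) (Less src height) = Some True"
    using Suc.prems(1,2) i by (simp add: frame_defs eval_defs)
  have len: "length (keep p acc (st ! i)) \<le> Suc i"
    using Suc.prems(7) by (simp add: keep_def)
  have drop: "drop i st = st ! i # drop (Suc i) st" using i by (simp add: Cons_nth_drop_Suc)
  have "wp w T compress_step (wp w T (While (Less src height) compress_step) Q) u I L (Suc q) ps"
  proof (rule wp_mono[OF wp_compress_step[OF Suc.prems(1-5) i Suc.prems(7-10)]])
    show "\<forall>m < length st. fst (st ! m) \<le> length w \<and> fst (snd (st ! m)) \<le> length w"
      using Suc.prems(11) by simp
  next
    fix u' I' L' q' ps'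
    assume *: "u' = u \<and> ps' = ps \<and> q' \<le> Suc q + 15 \<and>
      frame (length w) K p d (length st) v y x I' L' \<and> I' (4, 0) = Some (Suc i) \<and>
      I' (5, 0) = Some (length (keep p acc (st ! i))) \<and>
      (\<forall>m < length (keep p acc (st ! i)). stored I' L' m (keep p acc (st ! i) ! m)) \<and>
      (\<forall>m. Suc i \<le> m \<and> m < length st \<longrightarrow> stored I' L' m (st ! m))"
    have "wp w T (While (Less src height) compress_step) Q u I' L' q' ps"
    proof (rule Suc.hyps(1)[of "Suc i" I' L' "keep p acc (st ! i)"])
      show "Q u I'' L'' q'' ps"
        if "q'' \<le> q' + 16 * (length st - Suc i) + 1" "frame (length w) K p d (length st) v y x I'' L''"
          "I'' (5, 0) = Some (length (foldl (keep p) (keep p acc (st ! i)) (drop (Suc i) st)))"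
          "\<forall>m < length (foldl (keep p) (keep p acc (st ! i)) (drop (Suc i) st)).
             stored I'' L'' m (foldl (keep p) (keep p acc (st ! i)) (drop (Suc i) st) ! m)"
        for I'' L'' q''
        by (rule Suc.prems(12)) (use that * drop Suc_diff_Suc[OF i] in \<open>auto simp flip: Suc_diff_Suc[OF i]\<close>)
    qed (use * Suc.hyps(2) Suc.prems(8-11) i len in simp_all)
    then show "wp w T (While (Less src height) compress_step) Q u' I' L' q' ps'" using * by simp
  qed
  then show ?case by (intro wp_While) (simp only: test option.case if_True)
qed

text \<open>The constant 13 consists of five steps before the loop, its last test and seven steps
  after it.\<close>

lemma pre_push:
  assumes "frame (length w) K p d (length st) v (Close b) x I L"
    "\<forall>m < length st. stored I L m (st ! m)"
    "length st \<le> K" "length st \<le> length w" "p \<le> length w" "d \<le> length w"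
    "\<forall>e \<in> set st. fst e \<le> length w \<and> fst (snd e) \<le> length w"
    "length (compress p st) < K" "length (compress p st) < length w"
    "\<And>I' L' q'. q' \<le> q + 16 * length st + 13 \<Longrightarrow>
       frame (length w) K p d (Suc (length (compress p st))) v (Close b) x I' L' \<Longrightarrow>
       \<forall>m < Suc (length (compress p st)). stored I' L' m ((compress p st @ [(p, d, b)]) ! m) \<Longrightarrow>
       Q u I' L' q' ps"
  shows "pre w T push Q u I L q ps"
proof -
  have "wp w T (While (Less src height) compress_step)
      (pre w T (Set_Int height (Plus dst one) ;; Set_Int (positions 3) (Content pos) ;;
       Set_Int (depths 3) (Content depth) ;; Set_Letter (labels 3) [prev] hd) Q)
      u (I((4, 0) \<mapsto> 0, (5, 0) \<mapsto> 0)) L (Suc (Suc (Suc (Suc (Suc q))))) ps"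
  proof (rule wp_compress_loop[where i = 0 and acc = "[]" and st = st])
    fix I' L' q'
    assume *: "q' \<le> Suc (Suc (Suc (Suc (Suc q)))) + 16 * (length st - 0) + 1"
      "frame (length w) K p d (length st) v (Close b) x I' L'"
      "I' (5, 0) = Some (length (foldl (keep p) [] (drop 0 st)))"
      "\<forall>m < length (foldl (keep p) [] (drop 0 st)). stored I' L' m (foldl (keep p) [] (drop 0 st) ! m)"
    then show "pre w T (Set_Int height (Plus dst one) ;; Set_Int (positions 3) (Content pos) ;;
        Set_Int (depths 3) (Content depth) ;; Set_Letter (labels 3) [prev] hd) Q u I' L' q' ps"
      using assms(5,6,8,9)
      apply (simp add: frame_defs eval_defs compress_def[symmetric])
      apply (rule assms(10))
        apply simp
       apply (simp add: frame_defs)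
      apply (auto simp: stored_def nth_append less_Suc_eq)
      done
  qed (use assms in \<open>auto simp: frame_defs stored_def\<close>)
  then show ?thesis unfolding push_def using assms(1) by (simp add: eval_defs frame_defs)
qed

section \<open>The invariant of a pass and its cost per letter\<close>

text \<open>Compression leaves \<open>2 ^ length\<close> at most the position, which is at most
  \<open>n\<close>; the factor 2 pays for the entry pushed afterwards.\<close>

fun within_bounds :: "nat \<Rightarrow> 'a state \<Rightarrow> bool" where
  "within_bounds n (y, d, p, st, b) \<longleftrightarrow>
     d \<le> p \<and> (\<forall>e \<in> set st. fst e \<le> p \<and> fst (snd e) \<le> p) \<and> 2 ^ length st \<le> 2 * n"

text \<open>Between two letters \<open>prev\<close> and \<open>cur\<close> hold the same tag, hence
  \<open>y\<close> occurs twice.\<close>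

fun represents :: "nat \<Rightarrow> nat \<Rightarrow> 'a state \<Rightarrow> (loc \<rightharpoonup> nat) \<Rightarrow> (loc \<rightharpoonup> 'a tag) \<Rightarrow> bool" where
  "represents n K (y, d, p, st, b) I L \<longleftrightarrow>
     frame n K p d (length st) (of_bool b) y y I L \<and> (\<forall>m < length st. stored I L m (st ! m))"

fun position :: "'a state \<Rightarrow> nat" where
  "position (y, d, p, st, b) = p"

lemma position_astep: "position (astep V s x) = Suc (position s)"
proof -
  obtain y d p st b where "s = (y, d, p, st, b)" by (cases s) auto
  then show ?thesis by (cases y; cases x) auto
qed

lemma within_bounds_astep:
  assumes "within_bounds n s" "position s < n"
  shows "within_bounds n (astep V s x)"
proof -
  obtain y d p st b where s: "s = (y, d, p, st, b)" by (cases s) auto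
  have c: "2 ^ length (compress (Suc p) st) \<le> Suc p"
    by (rule length_compress) (use assms s in auto)
  have sub: "set (compress (Suc p) st) \<subseteq> set st" by (rule set_subseq[OF subseq_compress])
  show ?thesis
  proof (cases y; cases x)
    fix a a' assume yx: "y = Close a" "x = Open a'"
    have "2 ^ length (compress (Suc p) st) \<le> n" using c assms(2) s by simp
    then show ?thesis using assms s yx sub by fastforce
  next
    fix a a' assume yx: "y = Close a" "x = Close a'"
    have "2 ^ (length st - 1) \<le> (2 :: nat) ^ length st" by (intro power_increasing) auto
    also have "\<dots> \<le> 2 * n" using assms s by auto
    finally show ?thesis using assms s yx by (fastforce dest: in_set_butlastD)
  qed (use assms s in auto)
qed

text \<open>This turns the logarithmic bound into the fact that the stack height can be stored in an
  integer cell.\<close>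

lemma le_if_two_power_le: "2 ^ m \<le> 2 * n \<Longrightarrow> m \<le> (n :: nat)" if "0 < n"
proof (cases m)
  case (Suc j)
  assume "2 ^ m \<le> 2 * n"
  then have "2 ^ j \<le> n" using Suc by simp
  then show ?thesis using Suc less_exp[of j] by linarith
qed simp

text \<open>\<open>Read\<close> resets the clock, so the final bound is independent of
  \<open>q\<close>. The stack has at most \<open>K\<close> entries, each costing 16 steps in a
  compression.\<close>

lemma wp_letter_step:
  assumes "represents (length w) K s I L" "within_bounds (length w) s" "position s < length w"
    "\<And>m. 2 ^ m \<le> 2 * length w \<Longrightarrow> m \<le> K" "q + 1 \<le> T"
  shows "wp w T (letter_step f V) (\<lambda>u' I' L' q' ps'. u' = us \<and> ps' = ps \<and> q' \<le> 16 * K + 40 \<and>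
    represents (length w) K (astep V s (f z)) I' L') (z # us) I L q ps"
proof (rule wp_if_pre)
  obtain y d p st b where s: "s = (y, d, p, st, b)" by (cases s) auto
  have fr: "frame (length w) K p d (length st) (of_bool b) y y I L"
    and st: "\<forall>m < length st. stored I L m (st ! m)"
    and bd: "d \<le> p" "\<forall>e \<in> set st. fst e \<le> p \<and> fst (snd e) \<le> p" "2 ^ length st \<le> 2 * length w" "p < length w"
    using assms(1-3) s by auto
  have len: "length st \<le> K" "length st \<le> length w"
    using assms(4) bd le_if_two_power_le[of "length w" "length st"] by (blast, linarith)
  let ?Q = "\<lambda>u' I' L' q' ps'. u' = us \<and> ps' = ps \<and> q' \<le> 16 * K + 40 \<and>
    represents (length w) K (astep V s (f z)) I' L'"
  show "pre w T (letter_step f V) ?Q (z # us) I L q ps"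
  proof (cases y; cases "f z")
    fix a a' assume yx: "y = Open a" "f z = Open a'"
    show ?thesis unfolding letter_step_def
      using fr st bd assms(5) s yx by (simp add: frame_defs eval_defs) (simp add: stored_def)
  next
    fix a a' assume yx: "y = Open a" "f z = Close a'"
    show ?thesis unfolding letter_step_def check_def
      using fr st bd assms(5) s yx by (simp add: frame_defs eval_defs) (simp add: stored_def)
  next
    fix a a' assume yx: "y = Close a" "f z = Open a'"
    have "2 ^ length (compress (Suc p) st) \<le> Suc p"
      by (rule length_compress) (use bd in auto)
    then have "2 ^ Suc (length (compress (Suc p) st)) \<le> 2 * length w" using bd by simp
    then have "Suc (length (compress (Suc p) st)) \<le> K" "Suc (length (compress (Suc p) st)) \<le> length w"
      using assms(4) le_if_two_power_le[of "length w" "Suc (length (compress (Suc p) st))"] bd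
      by (blast, linarith)
    then have clen: "length (compress (Suc p) st) < K" "length (compress (Suc p) st) < length w"
      by (simp_all add: Suc_le_eq)
    show ?thesis unfolding letter_step_def
      using fr assms(5) s yx bd
      apply (simp add: frame_defs eval_defs split del: split_of_bool)
      apply (rule pre_push[where st = st and K = K and x = "f z" and b = a and p = "Suc p" and d = d and v = "of_bool b"])
               apply (simp add: frame_defs)
      using st clen len apply (simp_all add: stored_def)
      subgoal by fastforce
      subgoal by (auto simp: frame_defs eval_defs stored_def)
      done
  next
    fix a a' assume yx: "y = Close a" "f z = Close a'"
    show ?thesis
    proof (cases st rule: rev_cases)
      \<comment> \<open>The depth test reads register \<open>len\<close>, whose content exceeds
        \<open>d\<close> because \<open>d \<le> p < length w\<close>; the test fails as in
        \<open>astep\<close>.\<close>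
      case Nil
      then show ?thesis unfolding letter_step_def check_def
        using fr st bd assms(5) s yx by (simp add: frame_defs eval_defs)
    next
      case (snoc st' e)
      have top: "I (10, Suc (length st')) = Some (fst (snd e))" "L (2, Suc (length st')) = Some (Close (snd (snd e)))"
        using st snoc by (auto simp: stored_def)
      show ?thesis unfolding letter_step_def check_def
        using fr st bd assms(5) s yx top snoc len
        by (cases "fst (snd e) = d"; cases "V a' [snd (snd e), a]")
           (simp_all add: frame_defs eval_defs, simp_all add: stored_def nth_append)
    qed
  qed
qed

text \<open>After the 40 of \<open>letter_step\<close>, the loop test and the sequencing step before
  the next \<open>Read\<close> lead to 42 in the bound on \<open>T\<close>.\<close>

lemma wp_letters:
  assumes "represents (length w) K s I L" "within_bounds (length w) s"
    "position s + length u = length w" "\<And>m. 2 ^ m \<le> 2 * length w \<Longrightarrow> m \<le> K"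
    "q \<le> 16 * K + 40" "16 * K + 42 \<le> T"
  shows "wp w T (While (Less pos len) (letter_step f V)) (\<lambda>u' I' L' q' ps'. u' = [] \<and> ps' = ps \<and>
    q' \<le> 16 * K + 41 \<and> represents (length w) K (foldl (astep V) s (map f u)) I' L') u I L q ps"
  using assms
proof (induction u arbitrary: s I L q)
  case Nil
  obtain y d p st b where s: "s = (y, d, p, st, b)" by (cases s) auto
  have "test_value (cfg [] [] I L) (Less pos len) = Some False"
    using Nil.prems s by (simp add: frame_defs eval_defs)
  then show ?case using Nil.prems by (intro wp_While) simp
next
  case (Cons z us)
  obtain y d p st b where s: "s = (y, d, p, st, b)" by (cases s) auto
  have pos: "position s < length w" using Cons.prems(3) by simp
  then have test: "test_value (cfg [] (z # us) I L) (Less pos len) = Some True"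
    using Cons.prems(1) s by (simp add: frame_defs eval_defs)
  let ?R = "\<lambda>u' I' L' q' ps'. u' = [] \<and> ps' = ps \<and>
    q' \<le> 16 * K + 41 \<and> represents (length w) K (foldl (astep V) s (map f (z # us))) I' L'"
  have "wp w T (letter_step f V) (wp w T (While (Less pos len) (letter_step f V)) ?R) (z # us) I L (Suc q) ps"
  proof (rule wp_mono[OF wp_letter_step[OF Cons.prems(1,2) pos Cons.prems(4)]])
    show "wp w T (While (Less pos len) (letter_step f V)) ?R u' I' L' q' ps'"
      if "u' = us \<and> ps' = ps \<and> q' \<le> 16 * K + 40 \<and>
        represents (length w) K (astep V s (f z)) I' L'" for u' I' L' q' ps'
      using that Cons.IH[of "astep V s (f z)" I' L' q'] Cons.prems(3,4,6)
        within_bounds_astep[OF Cons.prems(2) pos] by (simp add: position_astep)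
  qed (use Cons.prems(5,6) in simp_all)
  then show ?case by (intro wp_While) (simp only: test option.case if_True)
qed

text \<open>Only the constant cells and the verdict are taken over from an earlier pass; resetting
  \<open>height\<close> to 0 hides old stack cells.\<close>

lemma pre_pass:
  fixes w :: "'a tag list"
  assumes "const_cells (length w) K (of_bool b) I L" "w \<noteq> []"
    "\<And>m. 2 ^ m \<le> 2 * length w \<Longrightarrow> m \<le> K" "q + 10 \<le> T" "16 * K + 42 \<le> T"
    "\<And>I' L' q'. q' \<le> 16 * K + 41 \<Longrightarrow>
      const_cells (length w) K
        (of_bool (verdict V b (map f (case d of Left_To_Right \<Rightarrow> w | Right_To_Left \<Rightarrow> rev w)))) I' L' \<Longrightarrow>
      Q [] I' L' q' (ps @ [d])"
  shows "pre w T (pass d f V) Q [] I L q ps"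
proof -
  define xs where "xs = (case d of Left_To_Right \<Rightarrow> w | Right_To_Left \<Rightarrow> rev w)"
  have len: "length xs = length w" by (simp add: xs_def split: direction.split)
  then obtain z us where zs: "xs = z # us" using assms(2) by (cases xs) auto
  have loop: "wp w T (While (Less pos len) (letter_step f V)) Q us I' L' q' (ps @ [d])"
    if "represents (length w) K (f z, 0, 1, [], b) I' L'" "q' \<le> 40" for I' L' q'
  proof (rule wp_mono[OF wp_letters[OF that(1) _ _ assms(3) _ assms(5)]])
    fix u'' :: "'a tag list" and I'' L'' q'' ps''
    assume *: "u'' = [] \<and> ps'' = ps @ [d] \<and> q'' \<le> 16 * K + 41 \<and>
      represents (length w) K (foldl (astep V) (f z, 0, 1, [], b) (map f us)) I'' L''"
    obtain y d' p st b' where s: "foldl (astep V) (f z, 0, 1, [], b) (map f us) = (y, d', p, st, b')"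
      by (rule prod_cases5)
    then have "verdict V b (map f xs) = b'" by (simp add: verdict_def zs)
    then show "Q u'' I'' L'' q'' ps''"
      using * s assms(6)[of q'' I'' L''] by (simp add: frame_def flip: xs_def)
  qed (use len zs assms(2) that in \<open>auto simp: Suc_le_eq\<close>)
  have "2 ^ 0 \<le> length w" using assms(2) by (simp add: Suc_le_eq)
  then show "pre w T (pass d f V) Q [] I L q ps"
    using assms(1,4) zs unfolding pass_def
    apply (simp add: const_cells_def eval_defs flip: xs_def)
    apply (rule loop[unfolded One_nat_def])
     apply (simp_all add: frame_defs)
    done
qed

section \<open>The complete computation and the asymptotic bounds\<close>

lemma wp_both_passes:
  fixes t :: "'a tree"
  assumes "binary t" "\<And>m. 2 ^ m \<le> 2 * length (XML t) \<Longrightarrow> m \<le> K" "16 * K + 60 \<le> T" "q \<le> 1"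
  shows "wp (XML t) T (both_passes D) (\<lambda>u' I' L' q' ps'. u' = [] \<and> q' \<le> 16 * K + 41 \<and>
    ps' = [Left_To_Right, Right_To_Left] \<and>
    const_cells (length (XML t)) K (of_bool (valid D t)) I' L') [] Map.empty Map.empty q []"
    (is "wp ?w _ _ ?Q _ _ _ _ _")
proof (rule wp_if_pre)
  have ne: "?w \<noteq> []" by (cases t) simp
  have passes: "pre ?w T (pass Left_To_Right id (\<lambda>a u. u \<in> lang (D a)))
      (pre ?w T (pass Right_To_Left swap_tag (\<lambda>a u. rev u \<in> lang (D a))) ?Q) [] I L q' []"
    if "const_cells (length ?w) K (of_bool True) I L" "q' \<le> 20" for I L q'
  proof (rule pre_pass[OF that(1) ne assms(2)])
    fix I1 and L1 :: "loc \<rightharpoonup> 'a tag" and q1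
    assume *: "q1 \<le> 16 * K + 41" "const_cells (length ?w) K (of_bool (verdict (\<lambda>a u. u \<in> lang (D a)) True
      (map id (case Left_To_Right of Left_To_Right \<Rightarrow> ?w | Right_To_Left \<Rightarrow> rev ?w)))) I1 L1"
    show "pre ?w T (pass Right_To_Left swap_tag (\<lambda>a u. rev u \<in> lang (D a))) ?Q [] I1 L1 q1 ([] @ [Left_To_Right])"
      by (rule pre_pass[OF *(2) ne assms(2)])
        (use * assms(3) in \<open>simp_all add: verdict_both[OF assms(1)]\<close>)
  qed (use that assms(3) in simp_all)
  have "1 \<le> length ?w" using ne by (simp add: Suc_le_eq)
  then show "pre ?w T (both_passes D) ?Q [] Map.empty Map.empty q []"
    unfolding both_passes_def using assms(4)
    apply (simp split del: split_of_bool)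
    apply (rule passes)
     apply (simp_all add: const_cells_def)
    done
qed

lemma program_computation:
  assumes "binary t" "\<And>m. 2 ^ m \<le> 2 * length (XML t) \<Longrightarrow> m \<le> K"
  shows "\<exists>cs. computation (program D) (XML t) cs \<and> bidirectional_two_pass cs \<and>
    answer (last cs) = Some (valid D t) \<and> processing_time cs \<le> 16 * K + 60 \<and>
    space_used (length (XML t)) cs \<le> 11 * Suc K * (nat \<lceil>log 2 (real (length (XML t) + 1))\<rceil> + 1)"
proof -
  let ?w = "XML t" and ?T = "16 * K + 60"
  let ?R = "(clocked_step ?w ?T)\<^sup>*\<^sup>*"
  define c :: "'a com" where "c = Cond (Equal ok one) (Answer True) (Answer False)"
  have "?R (initial (program D), 0, []) (cfg [both_passes D, c] [] Map.empty Map.empty, 1, [])"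
    by (rule r_into_rtranclp)
      (simp add: clocked_step_def step_def initial_def program_def c_def cfg_def reading_def pass_begun_def)
  moreover obtain I L q where run:
    "?R (cfg [both_passes D, c] [] Map.empty Map.empty, 1, []) (cfg [c] [] I L, q, [Left_To_Right, Right_To_Left])"
    "q \<le> 16 * K + 41" "const_cells (length ?w) K (of_bool (valid D t)) I L"
    using wp_both_passes[OF assms, of ?T 1 D] unfolding wp_def by blast
  moreover have "clocked_step ?w ?T (cfg [c] [] I L, q, ps) (cfg [Answer (valid D t)] [] I L, Suc q, ps)" for ps
    using run(3) by (simp add: clocked_step_def step_def c_def reading_def pass_begun_def eval_defs const_cells_def)
  moreover have "clocked_step ?w ?T (cfg [Answer (valid D t)] [] I L, Suc q, ps)
      ((cfg [] [] I L)\<lparr>answer := Some (valid D t)\<rparr>, Suc (Suc q), ps)" for ps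
    by (simp add: clocked_step_def step_def reading_def pass_begun_def cfg_def)
  ultimately have "?R (initial (program D), 0, [])
      ((cfg [] [] I L)\<lparr>answer := Some (valid D t)\<rparr>, Suc (Suc q), [Left_To_Right, Right_To_Left])"
    by (meson rtranclp.rtrancl_into_rtrancl rtranclp_trans)
  \<comment> \<open>Arrays 0 to 10 are in use, which gives the factor 11.\<close>
  from computation_bounds[OF this, of 10 K "length ?w"] run(2,3) show ?thesis
    by (auto simp: const_cells_def bidirectional_two_pass_def)
qed

theorem theorem2:
  fixes D :: "'a::finite dtd" and r :: 'a
  shows "\<exists>(P :: 'a com) (S :: nat \<Rightarrow> real) (T :: nat \<Rightarrow> real).
    S \<in> O(\<lambda>N. (log 2 (real N))\<^sup>2) \<and>
    T \<in> O(\<lambda>N. log 2 (real N)) \<and>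
    (\<forall>t :: 'a tree. root_label t = r \<and> binary t \<longrightarrow>
      (\<exists>cs. computation P (XML t) cs \<and>
            bidirectional_two_pass cs \<and>
            answer (last cs) = Some (valid D t) \<and>
            real (space_used (length (XML t)) cs) \<le> S (nodes t) \<and>
            real (processing_time cs) \<le> T (nodes t)))"
proof (rule exI[of _ "program D"],
    rule exI[of _ "\<lambda>N. 11 * (log 2 (4 * real N) + 1) * (log 2 (2 * real N + 1) + 2)"],
    rule exI[of _ "\<lambda>N. 16 * log 2 (4 * real N) + 60"], intro conjI allI impI)
  \<comment> \<open>Both bounds are positive at \<open>N = 1\<close>, where \<open>log 2 N\<close>
    vanishes; the comparison is only asymptotic.\<close>
  show "(\<lambda>N. 11 * (log 2 (4 * real N) + 1) * (log 2 (2 * real N + 1) + 2)) \<in> O(\<lambda>N. (log 2 (real N))\<^sup>2)"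
    by real_asymp
  show "(\<lambda>N. 16 * log 2 (4 * real N) + 60) \<in> O(\<lambda>N. log 2 (real N))"
    by real_asymp
next
  fix t :: "'a tree"
  assume t: "root_label t = r \<and> binary t"
  \<comment> \<open>The stream has \<open>2 * nodes t\<close> tags, so
    \<open>2 * length (XML t)\<close> is \<open>4 * nodes t\<close>, and \<open>K\<close> is the
    largest exponent allowed by \<open>within_bounds\<close>.\<close>
  define K where "K = nat \<lfloor>log 2 (4 * real (nodes t))\<rfloor>"
  have pos: "1 \<le> nodes t" by (cases t) simp
  have K: "real K \<le> log 2 (4 * real (nodes t))"
    unfolding K_def using pos by (intro of_nat_floor) simp
  have "m \<le> K" if "2 ^ m \<le> 2 * length (XML t)" for m
  proof -
    have "real (2 ^ m) \<le> real (4 * nodes t)" using that by (simp only: of_nat_le_iff length_XML)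
    then have "real m \<le> log 2 (4 * real (nodes t))"
      using pos by (simp add: le_log_iff powr_realpow)
    then show ?thesis unfolding K_def by (simp add: le_nat_floor)
  qed
  then obtain cs where cs: "computation (program D) (XML t) cs" "bidirectional_two_pass cs"
    "answer (last cs) = Some (valid D t)" "processing_time cs \<le> 16 * K + 60"
    "space_used (length (XML t)) cs \<le> 11 * Suc K * (nat \<lceil>log 2 (real (length (XML t) + 1))\<rceil> + 1)"
    using program_computation[of t K D] t by blast
  define B where "B = nat \<lceil>log 2 (real (length (XML t) + 1))\<rceil>"
  have log: "real B \<le> log 2 (2 * real (nodes t) + 1) + 1"
    using of_int_ceiling_le_add_one[of "log 2 (1 + real (nodes t) * 2)"]
    by (simp add: B_def length_XML algebra_simps)
  have "real (space_used (length (XML t)) cs)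
      \<le> 11 * (real K + 1) * (real B + 1)"
    using cs(5)[folded B_def of_nat_le_iff[where 'a = real]] by (simp add: algebra_simps)
  \<comment> \<open>The summand 2 collects the rounding up of the bit length and the 1 for letter
    cells.\<close>
  also have "\<dots> \<le> 11 * (log 2 (4 * real (nodes t)) + 1) * (log 2 (2 * real (nodes t) + 1) + 2)"
    using K log by (intro mult_mono) auto
  finally have space: "real (space_used (length (XML t)) cs)
      \<le> 11 * (log 2 (4 * real (nodes t)) + 1) * (log 2 (2 * real (nodes t) + 1) + 2)" .
  have "real (processing_time cs) \<le> 16 * real K + 60"
    using cs(4)[folded of_nat_le_iff[where 'a = real]] by simp
  then have "real (processing_time cs) \<le> 16 * log 2 (4 * real (nodes t)) + 60" using K by simp
  with cs(1-3) space show "\<exists>cs. computation (program D) (XML t) cs \<and> bidirectional_two_pass cs \<and>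
      answer (last cs) = Some (valid D t) \<and>
      real (space_used (length (XML t)) cs)
        \<le> 11 * (log 2 (4 * real (nodes t)) + 1) * (log 2 (2 * real (nodes t) + 1) + 2) \<and>
      real (processing_time cs) \<le> 16 * log 2 (4 * real (nodes t)) + 60"
    by blast
qed

end
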